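(* Let $\alpha\in(0,1)$ and $\beta\in(0,1]$ satisfy $\alpha\beta>\frac12$, let $B^{\alpha,\beta}=(B^{\alpha,\beta}(t))_{t\in[0,1]}$ be a bifractional Brownian motion with parameters $\alpha,\beta$, and let $(\varphi_n)_{n\ge1}$ be an orthonormal basis of the associated Hilbert space $\mathcal{H}$. Let $\varepsilon>0$ and $p\ge1$ be such that $\frac12<\alpha\beta-\varepsilon-\frac1p$. Then, almost surely, $$\sum_{n=1}^{N}\langle\varphi_n,\mathbf{1}_{[0,t]}\rangle_{\mathcal{H}}\,B^{\alpha,\beta}(\varphi_n)\ \underset{N\to+\infty}{\longrightarrow}\ B^{\alpha,\beta}(t)\qquad\text{in the Besov space }\mathbf{Bes}(\alpha\beta-\varepsilon,p),$$ i.e. the partial sums, viewed as functions of $t\in[0,1]$, converge to the sample path $t\mapsto B^{\alpha,\beta}(t)$ in the norm $\|\cdot\|_{\alpha\beta-\varepsilon,p}$.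
   Context: Bifractional Brownian motion with parameters $\alpha\in(0,1)$, $\beta\in(0,1]$: a centred real-valued Gaussian process $(B^{\alpha,\beta}(t))_{t\in[0,1]}$, with continuous sample paths, whose covariance function is $$R(s,t)=\frac{1}{2^\beta}\left((t^{2\alpha}+s^{2\alpha})^\beta-|t-s|^{2\alpha\beta}\right).$$ The Hilbert space $\mathcal{H}$ and the Wiener integral: let $\mathcal{E}$ be the linear space generated by the indicator functions $\mathbf{1}_{[0,t]}$, $t\in[0,1]$, endowed with the inner product determined by $\langle\mathbf{1}_{[0,t]},\mathbf{1}_{[0,s]}\rangle_{\mathcal{H}}=R(s,t)$, $s,t\in[0,1]$. $\mathcal{H}$ is the completion of $\mathcal{E}$ with respect to this inner product. The map $\varphi\mapsto B^{\alpha,\beta}(\varphi)$ is the linear isometry from $\mathcal{H}$ onto the Gaussian space generated by $B^{\alpha,\beta}$ (the closed linear span of $\{B^{\alpha,\beta}(t)\}$ in $L^2(\mathbb{P})$) that extends $\mathbf{1}_{[0,t]}\mapsto B^{\alpha,\beta}(t)$; $B^{\alpha,\beta}(\varphi)$ is called the Wiener integral of $\varphi$ with respect to $B^{\alpha,\beta}$. Besov spaces on $I=[0,1]$: for $1\le p<\infty$, $f\in L^p(I;\mathbb{R})$ and $t>0$ put $$\Delta_p(f,I)(t)=\sup_{|s|\le t}\left\{\int_{I_s}|f(x+s)-f(x)|^p\,dx\right\}^{1/p},\qquad I_s=\{x\in I:\ x+s\in I\}.$$ For $\gamma>0$ let $\|f\|_{\gamma,p}=\|f\|_{L^p(I)}+\sup_{0<t\le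 1}\frac{\Delta_p(f,I)(t)}{t^\gamma}$, and $\mathbf{Bes}(\gamma,p)=\{f\in L^p(I):\ \|f\|_{\gamma,p}<\infty\}$, normed by $\|\cdot\|_{\gamma,p}$. *)

theory Defs
  imports "HOL-Probability.Probability"
begin

section \<open>Bifractional Brownian motion\<close>

definition bifbm_cov :: "real \<Rightarrow> real \<Rightarrow> real \<Rightarrow> real \<Rightarrow> real" where
  "bifbm_cov \<alpha> \<beta> s t =
     1 / 2 powr \<beta> *
     ((t powr (2 * \<alpha>) + s powr (2 * \<alpha>)) powr \<beta> - \<bar>t - s\<bar> powr (2 * \<alpha> * \<beta>))"

text \<open>Degenerate (Dirac) laws count as Gaussian; this is needed since \<open>B 0 = 0\<close> almost surely.\<close>

definition gaussian_law :: "real \<Rightarrow> real \<Rightarrow> real measure" where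
  "gaussian_law \<mu> \<sigma> =
     (if \<sigma> = 0 then return borel \<mu> else density lborel (\<lambda>x. ennreal (normal_density \<mu> \<sigma> x)))"

text \<open>Processes are functions on all of \<open>real\<close>; only their values at times in \<open>{0..1}\<close> matter.\<close>

definition gaussian_process :: "'w measure \<Rightarrow> (real \<Rightarrow> 'w \<Rightarrow> real) \<Rightarrow> bool" where
  "gaussian_process M B \<longleftrightarrow>
     (\<forall>t\<in>{0..1}. B t \<in> borel_measurable M) \<and>
     (\<forall>T c. finite T \<and> T \<subseteq> {0..1} \<longrightarrow>
        (\<exists>\<mu> \<sigma>. 0 \<le> \<sigma> \<and> distr M borel (\<lambda>\<omega>. \<Sum>t\<in>T. c t * B t \<omega>) = gaussian_law \<mu> \<sigma>))"

definition bifractional_brownian_motion ::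
    "'w measure \<Rightarrow> real \<Rightarrow> real \<Rightarrow> (real \<Rightarrow> 'w \<Rightarrow> real) \<Rightarrow> bool" where
  "bifractional_brownian_motion M \<alpha> \<beta> B \<longleftrightarrow>
     gaussian_process M B \<and>
     (\<forall>t\<in>{0..1}. (LINT \<omega>|M. B t \<omega>) = 0) \<and>
     (\<forall>s\<in>{0..1}. \<forall>t\<in>{0..1}.
        (LINT \<omega>|M. (B s \<omega> - (LINT \<omega>'|M. B s \<omega>')) * (B t \<omega> - (LINT \<omega>'|M. B t \<omega>')))
          = bifbm_cov \<alpha> \<beta> s t) \<and>
     (\<forall>\<omega>\<in>space M. continuous_on {0..1} (\<lambda>t. B t \<omega>))"

section \<open>The Hilbert space and the Wiener integral\<close>

definition step_functions :: "(real \<Rightarrow> real) set" where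
  "step_functions =
     {f. \<exists>T c. finite T \<and> T \<subseteq> {0..1} \<and> f = (\<lambda>x. \<Sum>t\<in>T. c t * indicator {0..t} x)}"

text \<open>
  The Hilbert space is the (Hausdorff) completion of the step functions for the semi-inner product
  determined by \<^const>\<open>bifbm_cov\<close> on the generators. A completion is given by a complete
  inner product space (the type \<open>'h\<close>) together with a linear map \<open>\<iota>\<close> from the step functions
  that preserves the inner product and has dense range; such a pair is unique up to a unique
  isometric isomorphism. The map \<open>\<iota>\<close> sends the indicator of \<open>{0..0}\<close> to \<open>0\<close>,
  as \<open>bifbm_cov \<alpha> \<beta> 0 0 = 0\<close>. The indicators are linearly independent as functions, so
  linearity and the values on generators determine the inner product on all step functions.
\<close>

definition bifbm_hilbert_completion ::
    "real \<Rightarrow> real \<Rightarrow> ((real \<Rightarrow> real) \<Rightarrow> 'h::{real_inner, complete_space}) \<Rightarrow> bool" where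
  "bifbm_hilbert_completion \<alpha> \<beta> \<iota> \<longleftrightarrow>
     (\<forall>f\<in>step_functions. \<forall>g\<in>step_functions. \<forall>a b.
        \<iota> (\<lambda>x. a * f x + b * g x) = a *\<^sub>R \<iota> f + b *\<^sub>R \<iota> g) \<and>
     (\<forall>s\<in>{0..1}. \<forall>t\<in>{0..1}.
        inner (\<iota> (indicator {0..t})) (\<iota> (indicator {0..s})) = bifbm_cov \<alpha> \<beta> s t) \<and>
     closure (\<iota> ` step_functions) = UNIV"

text \<open>The index set of the basis is \<open>{1..}\<close>; the value of \<open>\<phi>\<close> at \<open>0\<close> is not used.\<close>

definition orthonormal_basis_seq :: "(nat \<Rightarrow> 'h::{real_inner, complete_space}) \<Rightarrow> bool" where
  "orthonormal_basis_seq \<phi> \<longleftrightarrow>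
     (\<forall>m\<ge>1. \<forall>n\<ge>1. inner (\<phi> m) (\<phi> n) = (if m = n then 1 else 0)) \<and>
     closure (span (\<phi> ` {1..})) = UNIV"

text \<open>Elements of \<open>L\<^sup>2\<close> are represented by functions, identified up to almost sure equality.\<close>

definition L2_space :: "'w measure \<Rightarrow> ('w \<Rightarrow> real) set" where
  "L2_space M = {X \<in> borel_measurable M. integrable M (\<lambda>\<omega>. (X \<omega>)\<^sup>2)}"

definition gaussian_space :: "'w measure \<Rightarrow> (real \<Rightarrow> 'w \<Rightarrow> real) \<Rightarrow> ('w \<Rightarrow> real) set" where
  "gaussian_space M B =
     {X \<in> L2_space M. \<forall>e>0. \<exists>T c. finite T \<and> T \<subseteq> {0..1} \<and>
        (LINT \<omega>|M. (X \<omega> - (\<Sum>t\<in>T. c t * B t \<omega>))\<^sup>2) < e}"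

text \<open>\<open>W h\<close> is a version of the Wiener integral of \<open>h\<close>; all identities hold in \<open>L\<^sup>2\<close>.\<close>

definition wiener_integral ::
    "'w measure \<Rightarrow> (real \<Rightarrow> 'w \<Rightarrow> real) \<Rightarrow> ((real \<Rightarrow> real) \<Rightarrow> 'h::{real_inner, complete_space})
      \<Rightarrow> ('h \<Rightarrow> 'w \<Rightarrow> real) \<Rightarrow> bool" where
  "wiener_integral M B \<iota> W \<longleftrightarrow>
     (\<forall>h. W h \<in> gaussian_space M B) \<and>
     (\<forall>X\<in>gaussian_space M B. \<exists>h. AE \<omega> in M. W h \<omega> = X \<omega>) \<and>
     (\<forall>h k a b. AE \<omega> in M. W (a *\<^sub>R h + b *\<^sub>R k) \<omega> = a * W h \<omega> + b * W k \<omega>) \<and>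
     (\<forall>h. sqrt (LINT \<omega>|M. (W h \<omega>)\<^sup>2) = norm h) \<and>
     (\<forall>t\<in>{0..1}. AE \<omega> in M. W (\<iota> (indicator {0..t})) \<omega> = B t \<omega>)"

section \<open>Besov spaces on the unit interval\<close>

definition Lp_space :: "real \<Rightarrow> (real \<Rightarrow> real) set" where
  "Lp_space p = {f \<in> borel_measurable (lebesgue_on {0..1}).
     integrable (lebesgue_on {0..1}) (\<lambda>x. \<bar>f x\<bar> powr p)}"

text \<open>
  Suprema are taken in \<^typ>\<open>ennreal\<close>, as the Besov norm may be infinite. The inner integrals are
  finite for \<open>f \<in> Lp_space p\<close>, the only case in which the modulus and the norm are meaningful.
\<close>

definition Lp_modulus :: "real \<Rightarrow> (real \<Rightarrow> real) \<Rightarrow> real \<Rightarrow> ennreal" where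
  "Lp_modulus p f t =
     (SUP s\<in>{s. \<bar>s\<bar> \<le> t}. ennreal
        ((LINT x|lebesgue_on {x \<in> {0..1}. x + s \<in> {0..1}}. \<bar>f (x + s) - f x\<bar> powr p) powr (1 / p)))"

definition besov_norm :: "real \<Rightarrow> real \<Rightarrow> (real \<Rightarrow> real) \<Rightarrow> ennreal" where
  "besov_norm \<gamma> p f =
     ennreal ((LINT x|lebesgue_on {0..1}. \<bar>f x\<bar> powr p) powr (1 / p)) +
     (SUP t\<in>{0<..1}. Lp_modulus p f t / ennreal (t powr \<gamma>))"

definition Bes :: "real \<Rightarrow> real \<Rightarrow> (real \<Rightarrow> real) set" where
  "Bes \<gamma> p = {f \<in> Lp_space p. besov_norm \<gamma> p f < \<infinity>}"

definition converges_in_Bes ::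
    "real \<Rightarrow> real \<Rightarrow> (nat \<Rightarrow> real \<Rightarrow> real) \<Rightarrow> (real \<Rightarrow> real) \<Rightarrow> bool" where
  "converges_in_Bes \<gamma> p F f \<longleftrightarrow>
     (\<forall>N. F N \<in> Bes \<gamma> p) \<and> f \<in> Bes \<gamma> p \<and>
     (\<lambda>N. besov_norm \<gamma> p (\<lambda>t. F N t - f t)) \<longlonglongrightarrow> 0"

end

theory Submission
  imports Defs
begin

text \<open>
  On \<open>{0..1}\<close> the Besov norm of order \<open>\<gamma>\<close> is dominated by the Hoelder norm of order \<open>\<gamma>\<close>, so it
  suffices to prove almost sure convergence in Hoelder norm for each \<open>\<gamma> < \<alpha> * \<beta>\<close>. The Wiener
  integrals of the basis vectors are independent standard normal variables. Hence the partial sums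
  of each increment form a martingale, closed by the increment of \<open>B\<close>, whose variance is at most
  \<open>2 * \<bar>t - s\<bar> powr (2 * \<alpha> * \<beta>)\<close>. Doob's inequality for high even moments bounds the supremum over
  \<open>N\<close> of the dyadic increments of the partial sums, and Borel--Cantelli with Kolmogorov chaining gives
  a Hoelder bound of order \<open>\<gamma>' > \<gamma>\<close> that is uniform in \<open>N\<close>. Together with almost sure pointwise
  convergence at the dyadic points this yields convergence in the Hoelder norm of order \<open>\<gamma>\<close>.
\<close>

section \<open>Dyadic chaining and the Besov norm\<close>

text \<open>High moments pay for the union bound: level \<open>n\<close> has \<open>2 ^ n\<close>
  increments, and the moment of order \<open>q\<close> turns the gap between \<alpha>\<beta> and
  \<gamma>' into a total probability of order
  \<open>2 powr (n * (1 - q * (\<alpha> * \<beta> - \<gamma>')))\<close>, summable once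
  \<open>q * (\<alpha> * \<beta> - \<gamma>') > 1\<close>. That one constant serves every
  \<open>N\<close> is Bessel's inequality: projecting onto the first \<open>N\<close> basis vectors
  does not increase the norm, and the moments of a centred Gaussian variable depend on that norm
  alone.

  Independence is not part of the data. Gaussian laws are given only for finite combinations of
  values of \<open>B\<close>, while a Wiener integral is a mean-square limit of such combinations.
  So the formula for the characteristic function is first carried to the limit, and independence is
  read off from its factorisation. Uniqueness of characteristic functions is applied to one real
  variable at a time; the other coordinates enter as a bounded weight on the measure.

  Chaining needs continuous paths. For the partial sums these come from the variance bound, which
  makes the time-indexed curve in the Hilbert space Hoelder continuous.\<close>

definition dyadic_approx :: "nat \<Rightarrow> real \<Rightarrow> real" where
  "dyadic_approx n t = of_int \<lfloor>2 ^ n * t\<rfloor> / 2 ^ n"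

lemma dyadic_approx_tendsto: "(\<lambda>n. dyadic_approx n t) \<longlonglongrightarrow> t"
proof (rule LIM_zero_cancel, rule Lim_null_comparison)
  show "\<forall>\<^sub>F n in sequentially. norm (dyadic_approx n t - t) \<le> inverse (2 ^ n) "
  proof (intro always_eventually allI)
    fix n
    have "dyadic_approx n t - t = (of_int \<lfloor>2 ^ n * t\<rfloor> - 2 ^ n * t) / 2 ^ n"
      by (simp add: dyadic_approx_def diff_divide_distrib)
    moreover have "\<bar>of_int \<lfloor>2 ^ n * t\<rfloor> - 2 ^ n * t\<bar> \<le> 1"
      by linarith
    ultimately show "norm (dyadic_approx n t - t) \<le> inverse (2 ^ n)"
      by (simp only: real_norm_def abs_divide inverse_eq_divide) (simp add: divide_right_mono)
  qed
qed (simp add: LIMSEQ_inverse_realpow_zero)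

lemma floor_dyadic_bounds:
  fixes t :: real
  assumes "t \<in> {0..1}"
  shows "0 \<le> \<lfloor>2 ^ n * t\<rfloor>" "\<lfloor>2 ^ n * t\<rfloor> \<le> 2 ^ n"
proof -
  have "2 ^ n * t \<le> of_int (2 ^ n)"
    using assms by simp
  from floor_mono[OF this] show "\<lfloor>2 ^ n * t\<rfloor> \<le> 2 ^ n"
    by (simp only: floor_of_int)
qed (use assms in simp)

lemma dyadic_approx_mem:
  assumes "t \<in> {0..1}"
  shows "dyadic_approx n t \<in> {0..1}"
proof -
  have "of_int \<lfloor>2 ^ n * t\<rfloor> \<le> (2 ^ n :: real)"
    using floor_dyadic_bounds(2)[OF assms, of n] by (metis of_int_le_iff of_int_numeral of_int_power)
  with floor_dyadic_bounds(1)[OF assms, of n] show ?thesis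
    by (simp add: dyadic_approx_def)
qed

definition dyadic_increments_le :: "nat \<Rightarrow> (real \<Rightarrow> real) \<Rightarrow> real \<Rightarrow> bool" where
  "dyadic_increments_le n f c \<longleftrightarrow> (\<forall>k<2 ^ n. \<bar>f (real (Suc k) / 2 ^ n) - f (real k / 2 ^ n)\<bar> \<le> c)"

text \<open>Integer indices allow floors to be inserted directly. The two may coincide, in which
  case \<open>0 \<le> c\<close> gives the bound.\<close>

lemma dyadic_increments_leD:
  assumes "dyadic_increments_le n f c" "0 \<le> c" "0 \<le> i" "i \<le> j" "j \<le> i + 1" "j \<le> 2 ^ n"
  shows "\<bar>f (real_of_int j / 2 ^ n) - f (real_of_int i / 2 ^ n)\<bar> \<le> c"
proof (cases "j = i")
  case False
  then have "j = i + 1" using assms by simp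
  moreover have "nat i < 2 ^ n"
    using assms \<open>j = i + 1\<close> by (simp add: nat_less_iff)
  ultimately show ?thesis
    using assms(1,3) unfolding dyadic_increments_le_def
    by (auto dest!: spec[of _ "nat i"] simp: add.commute)
qed (use assms in auto)

text \<open>Refining the grid either keeps the approximating point or moves it one fine step to the
  right, since the new floor is twice the old one or one more.\<close>

lemma dyadic_approx_step:
  assumes "dyadic_increments_le (Suc n) f c" "0 \<le> c" "t \<in> {0..1}"
  shows "\<bar>f (dyadic_approx (Suc n) t) - f (dyadic_approx n t)\<bar> \<le> c"
proof -
  define i where "i = \<lfloor>2 ^ n * t\<rfloor>"
  define j where "j = \<lfloor>2 ^ Suc n * t\<rfloor>"
  have "2 * i \<le> j" "j \<le> 2 * i + 1"
    unfolding i_def j_def by (simp_all add: le_floor_iff floor_le_iff) linarith+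
  moreover have "0 \<le> i" using assms(3) by (simp add: i_def)
  moreover have "j \<le> 2 ^ Suc n"
    using floor_dyadic_bounds(2)[OF assms(3)] unfolding j_def .
  moreover have "dyadic_approx n t = of_int (2 * i) / 2 ^ Suc n"
    by (simp add: dyadic_approx_def i_def)
  ultimately show ?thesis
    using dyadic_increments_leD[OF assms(1,2), of "2 * i" j]
    by (simp add: dyadic_approx_def j_def)
qed

text \<open>Times at most one grid width apart have equal or consecutive floors.\<close>

lemma dyadic_approx_neighbour:
  assumes "dyadic_increments_le n f c" "0 \<le> c" "s \<in> {0..1}" "t \<in> {0..1}" "s \<le> t" "t - s \<le> 1 / 2 ^ n"
  shows "\<bar>f (dyadic_approx n t) - f (dyadic_approx n s)\<bar> \<le> c"
proof -
  have "2 ^ n * t \<le> 2 ^ n * s + 1"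
    using assms(6) by (simp add: field_simps)
  then have "\<lfloor>2 ^ n * t\<rfloor> \<le> \<lfloor>2 ^ n * s\<rfloor> + 1"
    by linarith
  moreover have "\<lfloor>2 ^ n * s\<rfloor> \<le> \<lfloor>2 ^ n * t\<rfloor>"
    using assms(5) by (intro floor_mono) simp
  moreover have "\<lfloor>2 ^ n * t\<rfloor> \<le> 2 ^ n" "0 \<le> \<lfloor>2 ^ n * s\<rfloor>"
    using floor_dyadic_bounds assms by auto
  ultimately show ?thesis
    using dyadic_increments_leD[OF assms(1,2), of "\<lfloor>2 ^ n * s\<rfloor>" "\<lfloor>2 ^ n * t\<rfloor>"]
    by (simp add: dyadic_approx_def)
qed

text \<open>The steps from level \<open>n\<close> onwards telescope and are dominated by a geometric
  series; continuity of \<open>f\<close> identifies the limit of the approximations as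
  \<open>f t\<close>.\<close>

lemma dyadic_approx_error:
  assumes f: "continuous_on {0..1} f" and K: "0 \<le> K" and r: "0 < r" "r < 1"
    and inc: "\<And>n. dyadic_increments_le n f (K * r ^ n)" and t: "t \<in> {0..1}"
  shows "\<bar>f t - f (dyadic_approx n t)\<bar> \<le> K * r ^ n / (1 - r)"
proof -
  let ?a = "\<lambda>m. f (dyadic_approx m t)"
  have part: "\<bar>?a (n + m) - ?a n\<bar> \<le> (\<Sum>i<m. K * r ^ (n + i))" for m
  proof (induction m)
    case (Suc m)
    have "\<bar>?a (Suc (n + m)) - ?a (n + m)\<bar> \<le> K * r ^ (Suc (n + m))"
      using K r t by (intro dyadic_approx_step inc) auto
    also have "\<dots> \<le> K * r ^ (n + m)"
      using K r by (intro mult_left_mono power_decreasing) auto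
    finally show ?case using Suc by simp
  qed simp
  have le: "\<bar>?a (n + m) - ?a n\<bar> \<le> K * r ^ n / (1 - r)" for m
  proof -
    have "(\<Sum>i<m. r ^ i) \<le> 1 / (1 - r)"
      using r by (subst sum_gp_strict) (auto intro!: divide_right_mono)
    then have "K * r ^ n * (\<Sum>i<m. r ^ i) \<le> K * r ^ n * (1 / (1 - r))"
      using K r by (intro mult_left_mono) auto
    moreover have "(\<Sum>i<m. K * r ^ (n + i)) = K * r ^ n * (\<Sum>i<m. r ^ i)"
      by (simp add: power_add sum_distrib_left mult.assoc)
    ultimately show ?thesis using part[of m] by simp
  qed
  have "?a \<longlonglongrightarrow> f t"
    using dyadic_approx_mem[OF t]
    by (intro continuous_on_tendsto_compose[OF f dyadic_approx_tendsto t]) simp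
  then have "(\<lambda>m. ?a (n + m)) \<longlonglongrightarrow> f t"
    by (subst add.commute) (rule LIMSEQ_ignore_initial_segment)
  then have "(\<lambda>m. \<bar>?a (n + m) - ?a n\<bar>) \<longlonglongrightarrow> \<bar>f t - ?a n\<bar>"
    by (intro tendsto_intros)
  then show ?thesis
    by (rule LIMSEQ_le_const2) (use le in blast)
qed

text \<open>Two times are compared through their approximations at the level \<open>n\<close> with
  \<open>2 powr -(n + 1) < t - s \<le> 2 powr -n\<close>. In the constant,
  \<open>2 / (1 - 2 powr -\<gamma>)\<close> stands for the two approximation errors, 1 for the step
  between the grid points, and \<open>2 powr \<gamma>\<close> for the passage from
  \<open>2 powr -(n + 1)\<close> to \<open>t - s\<close>.\<close>

lemma holder_of_dyadic_increments:
  assumes f: "continuous_on {0..1} f" and K: "0 \<le> K" and g: "0 < \<gamma>"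
    and inc: "\<And>n. dyadic_increments_le n f (K * (2 powr -\<gamma>) ^ n)"
    and st: "s \<in> {0..1}" "t \<in> {0..1}"
  shows "\<bar>f t - f s\<bar> \<le> (2 / (1 - 2 powr -\<gamma>) + 1) * 2 powr \<gamma> * K * \<bar>t - s\<bar> powr \<gamma>"
  using st
proof (induction s t rule: linorder_wlog)
  case (le s t)
  define r :: real where "r = 2 powr -\<gamma>"
  have r: "0 < r" "r < 1"
    using g by (simp_all add: r_def powr_less_one)
  show ?case
  proof (cases "s = t")
    case False
    with le have d: "0 < t - s" "t - s \<le> 1" by auto
    define m where "m = \<lfloor>- log 2 (t - s)\<rfloor>"
    have "log 2 (t - s) \<le> 0" using d by simp
    then have "0 \<le> m" by (simp add: m_def)
    define n where "n = nat m"
    have "real n = of_int m" using \<open>0 \<le> m\<close> by (simp add: n_def)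
    then have "real n \<le> - log 2 (t - s)" "- log 2 (t - s) < real n + 1"
      unfolding m_def by linarith+
    then have n: "t - s \<le> 2 powr - real n" "2 powr - (real n + 1) < t - s"
      using d by (simp_all add: le_powr_iff powr_less_iff)
    have "\<bar>f t - f (dyadic_approx n t)\<bar> \<le> K * r ^ n / (1 - r)"
      "\<bar>f s - f (dyadic_approx n s)\<bar> \<le> K * r ^ n / (1 - r)"
      using dyadic_approx_error[OF f K r inc[folded r_def]] le by auto
    moreover have "\<bar>f (dyadic_approx n t) - f (dyadic_approx n s)\<bar> \<le> K * r ^ n"
      using le n r K by (intro dyadic_approx_neighbour inc[folded r_def])
        (auto simp: powr_minus powr_realpow divide_inverse)
    ultimately have "\<bar>f t - f s\<bar> \<le> K * r ^ n / (1 - r) + K * r ^ n / (1 - r) + K * r ^ n"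
      by linarith
    also have "\<dots> = (2 / (1 - r) + 1) * K * r ^ n"
      by (simp add: field_simps)
    also have "\<dots> \<le> (2 / (1 - r) + 1) * K * (2 powr \<gamma> * \<bar>t - s\<bar> powr \<gamma>)"
    proof (intro mult_left_mono)
      have "r ^ n = 2 powr (- \<gamma> * real n)"
        by (simp only: r_def powr_powr[symmetric]) (simp add: powr_realpow)
      also have "\<dots> = 2 powr \<gamma> * (2 powr - (real n + 1)) powr \<gamma>"
        by (simp add: powr_powr powr_add[symmetric] algebra_simps)
      also have "\<dots> \<le> 2 powr \<gamma> * \<bar>t - s\<bar> powr \<gamma>"
        using n(2) g by (intro mult_left_mono powr_mono2) auto
      finally show "r ^ n \<le> 2 powr \<gamma> * \<bar>t - s\<bar> powr \<gamma>" .
    qed (use r K in auto)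
    finally show ?thesis by (simp add: r_def mult_ac)
  qed (use r K in \<open>auto simp: r_def\<close>)
next
  case (sym s t)
  then show ?case by (simp add: abs_minus_commute)
qed

section \<open>Hoelder bounds as Besov bounds\<close>

lemma Lp_modulus_le_holder:
  assumes p: "1 \<le> p" and A: "0 \<le> A" and g: "0 < \<gamma>" and t: "0 \<le> t"
    and h: "\<And>x y. x \<in> {0..1} \<Longrightarrow> y \<in> {0..1} \<Longrightarrow> \<bar>f y - f x\<bar> \<le> A * \<bar>y - x\<bar> powr \<gamma>"
  shows "Lp_modulus p f t \<le> ennreal (A * t powr \<gamma>)"
  unfolding Lp_modulus_def
proof (rule SUP_least, rule ennreal_leI)
  fix s :: real assume "s \<in> {s. \<bar>s\<bar> \<le> t}"
  then have s: "\<bar>s\<bar> \<le> t" by simp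
  let ?I = "{x \<in> {0..1}. x + s \<in> {0..1::real}}"
  have I: "?I = {max 0 (-s)..min 1 (1 - s)}" by auto
  let ?L = "lebesgue_on ?I"
  have meas: "measure ?L (space ?L) \<le> 1" and fin: "emeasure ?L (space ?L) < \<infinity>"
    unfolding I by (auto simp: measure_restrict_space emeasure_restrict_space emeasure_lborel_Icc_eq)
  \<comment> \<open>Only the dominating constant has to be integrable: if the left integrand is not,
    its integral is 0 by default and the inequality still holds.\<close>
  have "(LINT x|?L. \<bar>f (x + s) - f x\<bar> powr p) \<le> (LINT x|?L. (A * t powr \<gamma>) powr p)"
  proof (rule integral_mono_AE')
    show "integrable ?L (\<lambda>x. (A * t powr \<gamma>) powr p)"
      by (rule finite_measure.integrable_const, rule finite_measureI) (use fin in simp)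
    show "AE x in ?L. \<bar>f (x + s) - f x\<bar> powr p \<le> (A * t powr \<gamma>) powr p"
    proof (rule AE_I2)
      fix x assume "x \<in> space ?L"
      then have x: "x \<in> {0..1}" "x + s \<in> {0..1}" by (auto simp: space_restrict_space)
      have "\<bar>f (x + s) - f x\<bar> \<le> A * \<bar>s\<bar> powr \<gamma>"
        using h[OF x] by simp
      also have "\<dots> \<le> A * t powr \<gamma>"
        using s A g by (intro mult_left_mono powr_mono2) auto
      finally show "\<bar>f (x + s) - f x\<bar> powr p \<le> (A * t powr \<gamma>) powr p"
        using p by (intro powr_mono2) auto
    qed
  qed auto
  also have "\<dots> \<le> (A * t powr \<gamma>) powr p"
    using meas by (simp add: mult_left_le_one_le)
  finally have "(LINT x|?L. \<bar>f (x + s) - f x\<bar> powr p) powr (1 / p) \<le> ((A * t powr \<gamma>) powr p) powr (1 / p)"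
    using p by (intro powr_mono2) (auto intro: integral_nonneg_AE)
  also have "\<dots> = A * t powr \<gamma>"
    using p A by (simp add: powr_powr)
  finally show "(LINT x|?L. \<bar>f (x + s) - f x\<bar> powr p) powr (1 / p) \<le> A * t powr \<gamma>" .
qed

text \<open>The factor 3 splits as 2 for the integral norm, because
  \<open>\<bar>f x\<bar> \<le> \<bar>f 0\<bar> + A\<close> on the unit interval, and 1 for the
  modulus.\<close>

lemma besov_norm_le_holder:
  assumes p: "1 \<le> p" and A: "0 \<le> A" and g: "0 < \<gamma>"
    and f0: "\<bar>f 0\<bar> \<le> A"
    and h: "\<And>x y. x \<in> {0..1} \<Longrightarrow> y \<in> {0..1} \<Longrightarrow> \<bar>f y - f x\<bar> \<le> A * \<bar>y - x\<bar> powr \<gamma>"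
  shows "besov_norm \<gamma> p f \<le> ennreal (3 * A)"
proof -
  let ?L = "lebesgue_on {0..1::real}"
  have "(LINT x|?L. \<bar>f x\<bar> powr p) \<le> (LINT x|?L. (2 * A) powr p)"
  proof (rule integral_mono_AE')
    show "integrable ?L (\<lambda>x. (2 * A) powr p)"
      by (simp add: emeasure_restrict_space)
    show "AE x in ?L. \<bar>f x\<bar> powr p \<le> (2 * A) powr p"
    proof (rule AE_I2)
      fix x assume "x \<in> space ?L"
      then have x: "x \<in> {0..1}" by (auto simp: space_restrict_space)
      have "\<bar>f x - f 0\<bar> \<le> A * \<bar>x\<bar> powr \<gamma>"
        using h[of 0 x] x by simp
      also have "\<dots> \<le> A * 1"
        using x A g by (intro mult_left_mono powr_le1) auto
      finally have "\<bar>f x\<bar> \<le> 2 * A" using f0 by linarith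
      then show "\<bar>f x\<bar> powr p \<le> (2 * A) powr p"
        using p by (intro powr_mono2) auto
    qed
  qed auto
  also have "\<dots> \<le> (2 * A) powr p"
    by (simp add: measure_restrict_space)
  finally have "(LINT x|?L. \<bar>f x\<bar> powr p) powr (1 / p) \<le> ((2 * A) powr p) powr (1 / p)"
    using p by (intro powr_mono2) (auto intro: integral_nonneg_AE)
  also have "\<dots> = 2 * A"
    using p A by (simp add: powr_powr)
  finally have 1: "ennreal ((LINT x|?L. \<bar>f x\<bar> powr p) powr (1 / p)) \<le> ennreal (2 * A)"
    by (rule ennreal_leI)
  have 2: "(SUP t\<in>{0<..1}. Lp_modulus p f t / ennreal (t powr \<gamma>)) \<le> ennreal A"
  proof (rule SUP_least)
    fix t :: real assume t: "t \<in> {0<..1}"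
    have "Lp_modulus p f t \<le> ennreal (A * t powr \<gamma>)"
      using Lp_modulus_le_holder[OF p A g _ h] t by simp
    then have "Lp_modulus p f t / ennreal (t powr \<gamma>) \<le> ennreal (A * t powr \<gamma>) / ennreal (t powr \<gamma>)"
      by (rule divide_right_mono_ennreal)
    also have "\<dots> = ennreal A"
      using t A by (simp add: divide_ennreal)
    finally show "Lp_modulus p f t / ennreal (t powr \<gamma>) \<le> ennreal A" .
  qed
  show ?thesis
    unfolding besov_norm_def using add_mono[OF 1 2] A by (simp flip: ennreal_plus)
qed

lemma continuous_holder_in_Bes:
  assumes p: "1 \<le> p" and A: "0 \<le> A" and g: "0 < \<gamma>" and f: "continuous_on {0..1} f"
    and h: "\<And>x y. x \<in> {0..1} \<Longrightarrow> y \<in> {0..1} \<Longrightarrow> \<bar>f y - f x\<bar> \<le> A * \<bar>y - x\<bar> powr \<gamma>"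
  shows "f \<in> Bes \<gamma> p"
proof -
  \<comment> \<open>The Hoelder constant is enlarged so that it also dominates the value at
    0.\<close>
  have "besov_norm \<gamma> p f \<le> ennreal (3 * max A \<bar>f 0\<bar>)"
  proof (rule besov_norm_le_holder[OF p _ g])
    fix x y :: real assume "x \<in> {0..1}" "y \<in> {0..1}"
    then have "\<bar>f y - f x\<bar> \<le> A * \<bar>y - x\<bar> powr \<gamma>" by (rule h)
    also have "\<dots> \<le> max A \<bar>f 0\<bar> * \<bar>y - x\<bar> powr \<gamma>" by (intro mult_right_mono) auto
    finally show "\<bar>f y - f x\<bar> \<le> max A \<bar>f 0\<bar> * \<bar>y - x\<bar> powr \<gamma>" .
  qed (use A in auto)
  then have "besov_norm \<gamma> p f < \<infinity>"
    by (auto intro: le_less_trans)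
  moreover have [measurable]: "f \<in> borel_measurable (lebesgue_on {0..1})"
    using f by (intro continuous_imp_measurable_on_sets_lebesgue) auto
  moreover have "integrable (lebesgue_on {0..1}) (\<lambda>x. \<bar>f x\<bar> powr p)"
  proof -
    have "bounded (f ` {0..1})"
      using f by (intro compact_imp_bounded compact_continuous_image) auto
    then obtain b where b: "\<And>x. x \<in> {0..1} \<Longrightarrow> \<bar>f x\<bar> \<le> b"
      unfolding bounded_real by blast
    interpret finite_measure "lebesgue_on {0..1::real}"
      by (intro finite_measureI) (simp add: emeasure_restrict_space)
    show ?thesis
      using b p by (intro integrable_const_bound[of _ "b powr p"] AE_I2)
        (auto intro!: powr_mono2)
  qed
  ultimately show ?thesis by (simp add: Bes_def Lp_space_def)
qed

text \<open>The increments of \<open>F N - f\<close> are small at the finitely many coarse levels by pointwise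
  convergence, and at the fine levels because \<open>\<gamma> < \<gamma>'\<close>.\<close>

lemma converges_in_Bes_of_dyadic_increments:
  assumes p: "1 \<le> p" and g: "0 < \<gamma>" "\<gamma> < \<gamma>'" and K: "0 \<le> K"
    and F: "\<And>N. continuous_on {0..1} (F N)" and f: "continuous_on {0..1} f"
    and inc: "\<And>N n. dyadic_increments_le n (F N) (K * (2 powr -\<gamma>') ^ n)"
    and lim: "\<And>n k. k \<le> 2 ^ n \<Longrightarrow> (\<lambda>N. F N (real k / 2 ^ n)) \<longlonglongrightarrow> f (real k / 2 ^ n)"
  shows "converges_in_Bes \<gamma> p F f"
proof -
  define C where "C = (2 / (1 - 2 powr -\<gamma>) + 1) * 2 powr \<gamma>"
  have "2 powr -\<gamma> < (1::real)" using g by (simp add: powr_less_one)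
  then have C: "0 \<le> C" by (auto simp: C_def)
  note holder = holder_of_dyadic_increments[OF _ _ g(1), folded C_def]
  have pw: "(2 powr -\<gamma>') ^ n \<le> ((2 powr -\<gamma>) ^ n :: real)" for n
    using g by (intro power_mono powr_mono) auto
  have weaken: "dyadic_increments_le n u b" if "dyadic_increments_le n u a" "a \<le> b" for n u and a b :: real
    using that by (force simp: dyadic_increments_le_def)
  \<comment> \<open>The increment bound is uniform in \<open>N\<close>, hence survives the limit at
    grid points.\<close>
  have inc_f: "dyadic_increments_le n f (K * (2 powr -\<gamma>') ^ n)" for n
    unfolding dyadic_increments_le_def
  proof (intro allI impI)
    fix k :: nat assume k: "k < 2 ^ n"
    then have "Suc k \<le> 2 ^ n" by simp
    then have "(\<lambda>N. \<bar>F N (real (Suc k) / 2 ^ n) - F N (real k / 2 ^ n)\<bar>)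
        \<longlonglongrightarrow> \<bar>f (real (Suc k) / 2 ^ n) - f (real k / 2 ^ n)\<bar>"
      using k by (intro tendsto_intros lim) auto
    then show "\<bar>f (real (Suc k) / 2 ^ n) - f (real k / 2 ^ n)\<bar> \<le> K * (2 powr -\<gamma>') ^ n"
      by (rule LIMSEQ_le_const2) (use inc k in \<open>auto simp: dyadic_increments_le_def\<close>)
  qed
  have le: "K * (2 powr -\<gamma>') ^ n \<le> K * (2 powr -\<gamma>) ^ n" for n
    using pw K by (intro mult_left_mono)
  have Bes: "u \<in> Bes \<gamma> p" if "continuous_on {0..1} u" "\<And>n. dyadic_increments_le n u (K * (2 powr -\<gamma>') ^ n)" for u
    using that weaken[OF that(2) le] C K
    by (intro continuous_holder_in_Bes[OF p _ g(1), of "C * K"] holder) auto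
  have "(\<lambda>N. besov_norm \<gamma> p (\<lambda>t. F N t - f t)) \<longlonglongrightarrow> 0"
  proof (rule order_tendstoI)
    fix a :: ennreal assume "0 < a"
    \<comment> \<open>Since \<open>a\<close> may be infinite, a finite \<open>e'\<close> is put
      below it and \<open>e\<close> is chosen with \<open>3 * ((C + 1) * e) = e'\<close>. The factor
      \<open>C + 1\<close> covers both the Hoelder constant \<open>C * e\<close> and the value at 0,
      which is below \<open>e\<close>.\<close>
    then obtain e' where e': "0 < e'" "e' < a" "e' < top"
      by (meson dense order_less_le_trans top_greatest)
    define e where "e = enn2real e' / (3 * (C + 1))"
    have e: "0 < e" "ennreal (3 * ((C + 1) * e)) < a"
    proof -
      show "0 < e" using e' C by (simp add: e_def enn2real_positive_iff)
      have "3 * ((C + 1) * e) = enn2real e'" using C by (simp add: e_def field_simps)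
      then show "ennreal (3 * ((C + 1) * e)) < a" using e' by simp
    qed
    have "(\<lambda>n. (2 powr (\<gamma> - \<gamma>')) ^ n) \<longlonglongrightarrow> (0::real)"
      by (rule LIMSEQ_realpow_zero) (use g in \<open>auto simp: powr_less_one\<close>)
    then have "(\<lambda>n. 2 * K * (2 powr (\<gamma> - \<gamma>')) ^ n) \<longlonglongrightarrow> 2 * K * 0"
      by (rule tendsto_mult[OF tendsto_const])
    then have "\<forall>\<^sub>F n in sequentially. 2 * K * (2 powr (\<gamma> - \<gamma>')) ^ n < e"
      using e(1) by (intro order_tendstoD(2)) auto
    \<comment> \<open>From level \<open>m\<close> on, the crude bound
      \<open>2 * K * (2 powr -\<gamma>') ^ n\<close> for an increment of the difference is below
      \<open>e * (2 powr -\<gamma>) ^ n\<close>.\<close>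
    then obtain m where m: "\<And>n. n \<ge> m \<Longrightarrow> 2 * K * (2 powr (\<gamma> - \<gamma>')) ^ n < e"
      by (auto simp: eventually_sequentially)
    \<comment> \<open>One tolerance serves all coarse levels, because
      \<open>(2 powr -\<gamma>) ^ m\<close> is the smallest of the weights up to \<open>m\<close>;
      the half is for the two endpoints of an increment.\<close>
    have small: "\<forall>\<^sub>F N in sequentially. \<forall>n<m. \<forall>k\<le>2 ^ n.
        \<bar>F N (real k / 2 ^ n) - f (real k / 2 ^ n)\<bar> < e * (2 powr -\<gamma>) ^ m / 2"
    proof -
      have "\<forall>\<^sub>F N in sequentially. \<forall>n\<in>{..<m}. \<forall>k\<in>{..2 ^ n}.
        \<bar>F N (real k / 2 ^ n) - f (real k / 2 ^ n)\<bar> < e * (2 powr -\<gamma>) ^ m / 2"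
      proof (intro eventually_ball_finite ballI)
        fix n and k :: nat assume "k \<in> {..2 ^ n}"
        then have "(\<lambda>N. F N (real k / 2 ^ n)) \<longlonglongrightarrow> f (real k / 2 ^ n)" by (intro lim) auto
        moreover have "0 < e * (2 powr -\<gamma>) ^ m / 2" using e by simp
        ultimately show "\<forall>\<^sub>F N in sequentially.
            \<bar>F N (real k / 2 ^ n) - f (real k / 2 ^ n)\<bar> < e * (2 powr -\<gamma>) ^ m / 2"
          unfolding dist_real_def[symmetric] by (rule tendstoD)
      qed auto
      then show ?thesis by (rule eventually_mono) auto
    qed
    \<comment> \<open>Increments determine the difference only up to a constant, so its value at 0
      is controlled separately.\<close>
    have small0: "\<forall>\<^sub>F N in sequentially. \<bar>F N 0 - f 0\<bar> < e"
      using tendstoD[OF lim[of 0 0] e(1)] by (simp add: dist_real_def)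
    show "\<forall>\<^sub>F N in sequentially. besov_norm \<gamma> p (\<lambda>t. F N t - f t) < a"
      using small small0
    proof eventually_elim
      case (elim N)
      let ?d = "\<lambda>t. F N t - f t"
      have "dyadic_increments_le n ?d (e * (2 powr -\<gamma>) ^ n)" for n
        unfolding dyadic_increments_le_def
      proof (intro allI impI)
        fix k :: nat assume k: "k < 2 ^ n"
        let ?x = "real (Suc k) / 2 ^ n" and ?y = "real k / 2 ^ n"
        show "\<bar>F N ?x - f ?x - (F N ?y - f ?y)\<bar> \<le> e * (2 powr -\<gamma>) ^ n"
        proof (cases "n < m")
          case True
          then have "\<bar>F N ?x - f ?x\<bar> < e * (2 powr -\<gamma>) ^ m / 2" "\<bar>F N ?y - f ?y\<bar> < e * (2 powr -\<gamma>) ^ m / 2"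
            using k elim(1) by (auto simp del: of_nat_Suc)
          then have "\<bar>F N ?x - f ?x - (F N ?y - f ?y)\<bar> \<le> e * (2 powr -\<gamma>) ^ m" by linarith
          also have "\<dots> \<le> e * (2 powr -\<gamma>) ^ n"
            using True e(1) g by (intro mult_left_mono power_decreasing) (auto simp: less_imp_le powr_less_one)
          finally show ?thesis .
        next
          case False
          have "\<bar>F N ?x - F N ?y\<bar> \<le> K * (2 powr -\<gamma>') ^ n" "\<bar>f ?x - f ?y\<bar> \<le> K * (2 powr -\<gamma>') ^ n"
            using inc[of n N] inc_f[of n] k by (auto simp: dyadic_increments_le_def)
          then have "\<bar>F N ?x - f ?x - (F N ?y - f ?y)\<bar> \<le> 2 * K * (2 powr -\<gamma>') ^ n" by linarith
          also have "\<dots> = 2 * K * (2 powr (\<gamma> - \<gamma>')) ^ n * (2 powr -\<gamma>) ^ n"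
            by (simp add: power_mult_distrib[symmetric] powr_add[symmetric])
          also have "\<dots> \<le> e * (2 powr -\<gamma>) ^ n"
            using m[of n] False by (intro mult_right_mono) auto
          finally show ?thesis .
        qed
      qed
      then have hold: "\<bar>?d y - ?d x\<bar> \<le> C * e * \<bar>y - x\<bar> powr \<gamma>" if "x \<in> {0..1}" "y \<in> {0..1}" for x y
        using that e(1) F f by (intro holder) (auto intro!: continuous_intros)
      have "besov_norm \<gamma> p ?d \<le> ennreal (3 * ((C + 1) * e))"
      proof (rule besov_norm_le_holder[OF p _ g(1)])
        fix x y :: real assume "x \<in> {0..1}" "y \<in> {0..1}"
        then have "\<bar>?d y - ?d x\<bar> \<le> C * e * \<bar>y - x\<bar> powr \<gamma>" by (rule hold)
        also have "\<dots> \<le> (C + 1) * e * \<bar>y - x\<bar> powr \<gamma>"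
          using e(1) by (intro mult_right_mono) auto
        finally show "\<bar>?d y - ?d x\<bar> \<le> (C + 1) * e * \<bar>y - x\<bar> powr \<gamma>" .
      next
        have "0 \<le> C * e" using C e(1) by simp
        then show "\<bar>?d 0\<bar> \<le> (C + 1) * e"
          using elim(2) by (simp add: algebra_simps)
      qed (use C e in auto)
      then show ?case using e(2) by (rule le_less_trans)
    qed
  qed auto
  then show ?thesis
    unfolding converges_in_Bes_def using Bes[OF F inc] Bes[OF f inc_f] by blast
qed

section \<open>Independence from characteristic functions\<close>

text \<open>Levy uniqueness concerns probability measures, whereas \<open>Z\<close> may be negative.
  The hypothesis at \<open>t = 0\<close> gives \<open>expectation Z = z\<close>, so
  \<open>w = (2 + Z) / (2 + z)\<close> is a probability density; the shift by 2 keeps the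
  denominator at least 1. Under this density \<open>X\<close> keeps its characteristic function and
  hence its law, and undoing the shift gives the claim.\<close>

lemma (in prob_space) weighted_char_unique_real:
  fixes X Z :: "'a \<Rightarrow> real"
  assumes [measurable]: "random_variable borel X" "random_variable borel Z"
    and Z: "\<And>\<omega>. \<bar>Z \<omega>\<bar> \<le> 1"
    and char: "\<And>t. (CLINT \<omega>|M. of_real (Z \<omega>) * iexp (t * X \<omega>)) = of_real z * (CLINT \<omega>|M. iexp (t * X \<omega>))"
    and A[measurable]: "A \<in> sets borel"
  shows "expectation (\<lambda>\<omega>. Z \<omega> * indicator A (X \<omega>)) = z * prob (X -` A \<inter> space M)"
proof -
  have [simp]: "integrable M Z"
    using Z by (intro integrable_const_bound[of _ 1]) auto
  have [simp]: "integrable M (\<lambda>\<omega>. of_real (Z \<omega>) * iexp (t * X \<omega>))" "integrable M (\<lambda>\<omega>. iexp (t * X \<omega>))" for t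
    using Z by (auto intro!: integrable_const_bound[of _ 1] simp: norm_mult simp del: of_real_mult)
  have EZ: "expectation Z = z"
    using char[of 0] by (simp add: prob_space)
  have "\<bar>expectation Z\<bar> \<le> expectation (\<lambda>_. 1)"
    using Z by (intro order_trans[OF integral_abs_bound] integral_mono) auto
  then have z: "\<bar>z\<bar> \<le> 1" using EZ by (simp add: prob_space)
  define w where "w \<omega> = (2 + Z \<omega>) / (2 + z)" for \<omega>
  have [measurable]: "w \<in> borel_measurable M" unfolding w_def by simp
  have w0: "0 \<le> w \<omega>" for \<omega>
    using Z[of \<omega>] z by (auto simp: w_def intro!: divide_nonneg_nonneg)
  have wint: "integrable M w" unfolding w_def by simp
  have "expectation w = 1"
    unfolding w_def using EZ z by (simp add: prob_space)
  then have "(\<integral>\<^sup>+\<omega>. ennreal (w \<omega>) \<partial>M) = 1"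
    using w0 wint by (simp add: nn_integral_eq_integral)
  then interpret D: prob_space "density M (\<lambda>\<omega>. ennreal (w \<omega>))"
    by (intro prob_spaceI) (simp add: emeasure_density cong: nn_integral_cong)
  let ?D = "density M (\<lambda>\<omega>. ennreal (w \<omega>))"
  have "char (distr ?D borel X) t = char (distr M borel X) t" for t
  proof -
    have "char (distr ?D borel X) t = (CLINT \<omega>|M. w \<omega> *\<^sub>R iexp (t * X \<omega>))"
      unfolding char_def using w0
      by (subst integral_distr, simp, simp) (subst integral_density, auto)
    also have "\<dots> = (CLINT \<omega>|M. (2 * iexp (t * X \<omega>) + of_real (Z \<omega>) * iexp (t * X \<omega>)) / of_real (2 + z))"
      by (simp add: w_def scaleR_conv_of_real field_simps)
    also have "\<dots> = (2 * (CLINT \<omega>|M. iexp (t * X \<omega>)) + of_real z * (CLINT \<omega>|M. iexp (t * X \<omega>))) / of_real (2 + z)"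
      by (simp only: char[symmetric]) (simp del: of_real_mult of_real_add)
    also have "\<dots> = (CLINT \<omega>|M. iexp (t * X \<omega>)) * (of_real (2 + z) / of_real (2 + z))"
      by (simp add: field_simps)
    also have "of_real (2 + z) / of_real (2 + z) = (1::complex)"
    proof (rule divide_self)
      have "2 + z \<noteq> 0" using z by linarith
      then show "complex_of_real (2 + z) \<noteq> 0" by (simp only: of_real_eq_0_iff not_False_eq_True)
    qed
    finally show ?thesis
      by (simp add: char_def integral_distr)
  qed
  then have "distr ?D borel X = distr M borel X"
    by (intro Levy_uniqueness ext) (auto intro!: real_distribution_distr D.real_distribution_distr)
  then have "expectation (\<lambda>\<omega>. indicator A (X \<omega>)) = (LINT x|distr ?D borel X. indicator A x :: real)"
    by (simp only: integral_distr[OF assms(1)] borel_measurable_indicator A)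
  also have "\<dots> = expectation (\<lambda>\<omega>. w \<omega> * indicator A (X \<omega>))"
    using w0 by (subst integral_distr, simp, simp) (subst integral_density, auto)
  finally have "expectation (\<lambda>\<omega>. w \<omega> * indicator A (X \<omega>)) = expectation (\<lambda>\<omega>. indicator A (X \<omega>))" ..
  moreover have E: "expectation (\<lambda>\<omega>. indicator A (X \<omega>)) = prob (X -` A \<inter> space M)"
    by (simp add: indicator_vimage[symmetric] indicator_inter_arith[symmetric])
  moreover have i: "integrable M (\<lambda>\<omega>. indicator A (X \<omega>) :: real)" "integrable M (\<lambda>\<omega>. Z \<omega> * indicator A (X \<omega>))"
    using Z by (auto intro!: integrable_const_bound[of _ 1] simp: indicator_def)
  moreover have "expectation (\<lambda>\<omega>. w \<omega> * indicator A (X \<omega>)) =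
      (2 * expectation (\<lambda>\<omega>. indicator A (X \<omega>)) + expectation (\<lambda>\<omega>. Z \<omega> * indicator A (X \<omega>))) / (2 + z)"
    unfolding w_def using i by (simp add: distrib_right add_divide_distrib)
  moreover have "2 + z \<noteq> 0" using z by linarith
  ultimately show ?thesis by (simp add: field_simps)
qed

text \<open>The real case is applied to the real and imaginary parts of \<open>Z\<close>.\<close>

lemma (in prob_space) weighted_char_unique:
  fixes X :: "'a \<Rightarrow> real" and Z :: "'a \<Rightarrow> complex"
  assumes [measurable]: "random_variable borel X" "random_variable borel Z"
    and Z: "\<And>\<omega>. norm (Z \<omega>) \<le> 1"
    and char: "\<And>t. (CLINT \<omega>|M. Z \<omega> * iexp (t * X \<omega>)) = z * (CLINT \<omega>|M. iexp (t * X \<omega>))"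
    and A[measurable]: "A \<in> sets borel"
  shows "(CLINT \<omega>|M. Z \<omega> * indicator A (X \<omega>)) = z * prob (X -` A \<inter> space M)"
proof -
  have [simp]: "integrable M (\<lambda>\<omega>. Z \<omega> * iexp (t * X \<omega>))" for t
    using Z by (intro integrable_const_bound[of _ 1]) (auto simp: norm_mult simp del: of_real_mult)
  have [measurable]: "(\<lambda>\<omega>. cnj (Z \<omega>)) \<in> borel_measurable M"
    by (rule borel_measurable_continuous_on[OF _ assms(2)]) (intro continuous_intros)
  then have [simp]: "integrable M (\<lambda>\<omega>. cnj (Z \<omega>) * iexp (t * X \<omega>))" for t
    using Z by (intro integrable_const_bound[of _ 1]) (auto simp: norm_mult simp del: of_real_mult)
  \<comment> \<open>Conjugation turns the hypothesis at \<open>-t\<close> into the one for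
    \<open>cnj Z\<close> at \<open>t\<close>, so the hypothesis passes to both parts of
    \<open>Z\<close>.\<close>
  have cnj: "(CLINT \<omega>|M. cnj (Z \<omega>) * iexp (t * X \<omega>)) = cnj z * (CLINT \<omega>|M. iexp (t * X \<omega>))" for t
  proof -
    have "(CLINT \<omega>|M. cnj (Z \<omega>) * iexp (t * X \<omega>)) = cnj (CLINT \<omega>|M. Z \<omega> * iexp (- t * X \<omega>))"
      by (simp only: Bochner_Integration.integral_cnj[symmetric] complex_cnj_mult) (simp add: exp_cnj)
    also have "\<dots> = cnj z * (CLINT \<omega>|M. iexp (t * X \<omega>))"
      by (subst char) (simp only: Bochner_Integration.integral_cnj[symmetric] complex_cnj_mult, simp add: exp_cnj)
    finally show ?thesis .
  qed
  have Re: "expectation (\<lambda>\<omega>. Re (Z \<omega>) * indicator A (X \<omega>)) = Re z * prob (X -` A \<inter> space M)"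
  proof (rule weighted_char_unique_real)
    show "\<bar>Re (Z \<omega>)\<bar> \<le> 1" for \<omega>
      using Z[of \<omega>] abs_Re_le_cmod[of "Z \<omega>"] by linarith
    fix t
    have "(CLINT \<omega>|M. of_real (Re (Z \<omega>)) * iexp (t * X \<omega>)) =
        (CLINT \<omega>|M. (Z \<omega> * iexp (t * X \<omega>) + cnj (Z \<omega>) * iexp (t * X \<omega>)) / 2)"
      by (intro Bochner_Integration.integral_cong refl) (simp add: distrib_right[symmetric] complex_add_cnj)
    also have "\<dots> = (z + cnj z) / 2 * (CLINT \<omega>|M. iexp (t * X \<omega>))"
      by (simp add: char cnj distrib_right del: of_real_mult)
    finally show "(CLINT \<omega>|M. of_real (Re (Z \<omega>)) * iexp (t * X \<omega>)) = of_real (Re z) * (CLINT \<omega>|M. iexp (t * X \<omega>))"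
      by (simp add: complex_add_cnj)
  qed auto
  have Im: "expectation (\<lambda>\<omega>. Im (Z \<omega>) * indicator A (X \<omega>)) = Im z * prob (X -` A \<inter> space M)"
  proof (rule weighted_char_unique_real)
    show "\<bar>Im (Z \<omega>)\<bar> \<le> 1" for \<omega>
      using Z[of \<omega>] abs_Im_le_cmod[of "Z \<omega>"] by linarith
    fix t
    have Im: "of_real (Im u) = (u - cnj u) / (2 * \<i>)" for u
      by (simp add: complex_diff_cnj, simp add: complex_eq_iff)
    have "(CLINT \<omega>|M. of_real (Im (Z \<omega>)) * iexp (t * X \<omega>)) =
        (CLINT \<omega>|M. (Z \<omega> * iexp (t * X \<omega>) - cnj (Z \<omega>) * iexp (t * X \<omega>)) / (2 * \<i>))"
      unfolding Im by (simp only: left_diff_distrib times_divide_eq_left)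
    also have "\<dots> = (z - cnj z) / (2 * \<i>) * (CLINT \<omega>|M. iexp (t * X \<omega>))"
      by (simp add: char cnj left_diff_distrib del: of_real_mult)
    finally show "(CLINT \<omega>|M. of_real (Im (Z \<omega>)) * iexp (t * X \<omega>)) = of_real (Im z) * (CLINT \<omega>|M. iexp (t * X \<omega>))"
      unfolding Im .
  qed auto
  have "integrable M (\<lambda>\<omega>. Z \<omega> * indicator A (X \<omega>))"
    using Z by (intro integrable_const_bound[of _ 1]) (auto simp: indicator_def)
  moreover have "Re (Z \<omega> * indicator A (X \<omega>)) = Re (Z \<omega>) * indicator A (X \<omega>)"
    "Im (Z \<omega> * indicator A (X \<omega>)) = Im (Z \<omega>) * indicator A (X \<omega>)" for \<omega>
    by (auto simp: indicator_def)
  ultimately show ?thesis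
    using Re Im by (simp add: complex_eq_iff flip: integral_Re integral_Im)
qed

text \<open>Kac's criterion. The exponentials are replaced by indicators one coordinate at a time.\<close>

lemma (in prob_space) indep_vars_of_char_factorization:
  fixes X :: "'i \<Rightarrow> 'a \<Rightarrow> real"
  assumes I: "finite I" and X: "\<And>i. i \<in> I \<Longrightarrow> random_variable borel (X i)"
    and char: "\<And>c. (CLINT \<omega>|M. iexp (\<Sum>i\<in>I. c i * X i \<omega>)) = (\<Prod>i\<in>I. CLINT \<omega>|M. iexp (c i * X i \<omega>))"
  shows "indep_vars (\<lambda>_. borel) X I"
proof -
  \<comment> \<open>\<open>K\<close> holds the coordinates whose exponential is already an
    indicator. The coefficients \<open>c\<close> stay arbitrary, because the induction step sets the
    coefficient of the next coordinate to a free \<open>t\<close>.\<close>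
  have main: "(CLINT \<omega>|M. (\<Prod>i\<in>K. indicator (A i) (X i \<omega>)) * iexp (\<Sum>i\<in>I - K. c i * X i \<omega>))
      = (\<Prod>i\<in>K. of_real (prob (X i -` A i \<inter> space M))) * (\<Prod>i\<in>I - K. CLINT \<omega>|M. iexp (c i * X i \<omega>))"
    if K: "finite K" "K \<subseteq> I" and A: "\<And>i. i \<in> K \<Longrightarrow> A i \<in> sets borel" for K A c
    using K A
  proof (induction K arbitrary: c rule: finite_induct)
    case empty
    then show ?case using char by simp
  next
    case (insert k K)
    have k: "k \<in> I" "I - K = insert k (I - insert k K)" "k \<notin> I - insert k K" "finite (I - insert k K)"
    proof -
      show "k \<in> I" using insert by simp
      then show "I - K = insert k (I - insert k K)" using insert(2) by blast
    qed (use I in auto)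
    have [measurable]: "X k \<in> borel_measurable M" "A k \<in> sets borel"
      using X k(1) insert by auto
    have [measurable]: "(\<lambda>\<omega>. \<Prod>i\<in>K. indicator (A i) (X i \<omega>) :: complex) \<in> borel_measurable M"
    proof (intro borel_measurable_prod)
      fix i assume "i \<in> K"
      then have [measurable]: "X i \<in> borel_measurable M" "A i \<in> sets borel"
        using X insert by auto
      show "(\<lambda>\<omega>. indicator (A i) (X i \<omega>) :: complex) \<in> borel_measurable M" by measurable
    qed
    have [measurable]: "(\<lambda>\<omega>. \<Sum>i\<in>I - insert k K. c i * X i \<omega>) \<in> borel_measurable M"
      using X by (intro borel_measurable_sum borel_measurable_times) auto
    \<comment> \<open>Everything except coordinate \<open>k\<close> forms a weight of modulus at
      most 1; the induction hypothesis says that it factors out of the characteristic function of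
      \<open>X k\<close>.\<close>
    define Z where "Z \<omega> = (\<Prod>i\<in>K. indicator (A i) (X i \<omega>)) * iexp (\<Sum>i\<in>I - insert k K. c i * X i \<omega>)" for \<omega>
    define z where "z = (\<Prod>i\<in>K. of_real (prob (X i -` A i \<inter> space M))) * (\<Prod>i\<in>I - insert k K. CLINT \<omega>|M. iexp (c i * X i \<omega>))"
    have "(CLINT \<omega>|M. Z \<omega> * indicator (A k) (X k \<omega>)) = z * prob (X k -` A k \<inter> space M)"
    proof (rule weighted_char_unique)
      show "Z \<in> borel_measurable M" unfolding Z_def by measurable
      have "norm (\<Prod>i\<in>K. indicator (A i) (X i \<omega>) :: complex) \<le> 1" for \<omega>
        unfolding prod_norm[symmetric] by (intro prod_le_1) (auto simp: indicator_def)
      then show "norm (Z \<omega>) \<le> 1" for \<omega> by (simp add: Z_def norm_mult del: of_real_sum)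
      fix t
      have s: "(\<Sum>i\<in>I - K. (c(k := t)) i * X i \<omega>) = t * X k \<omega> + (\<Sum>i\<in>I - insert k K. c i * X i \<omega>)" for \<omega>
        unfolding k(2) using k(3,4) by (subst sum.insert) (auto intro!: sum.cong)
      have p: "(\<Prod>i\<in>I - K. CLINT \<omega>|M. iexp ((c(k := t)) i * X i \<omega>)) =
          (CLINT \<omega>|M. iexp (t * X k \<omega>)) * (\<Prod>i\<in>I - insert k K. CLINT \<omega>|M. iexp (c i * X i \<omega>))"
        unfolding k(2) using k(3,4) by (subst prod.insert) (auto intro!: prod.cong)
      have "(CLINT \<omega>|M. Z \<omega> * iexp (t * X k \<omega>)) =
          (CLINT \<omega>|M. (\<Prod>i\<in>K. indicator (A i) (X i \<omega>)) * iexp (\<Sum>i\<in>I - K. (c(k := t)) i * X i \<omega>))"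
        unfolding s Z_def by (simp add: exp_add distrib_left mult_ac del: of_real_sum)
      also have "\<dots> = (\<Prod>i\<in>K. of_real (prob (X i -` A i \<inter> space M))) *
          (\<Prod>i\<in>I - K. CLINT \<omega>|M. iexp ((c(k := t)) i * X i \<omega>))"
        using insert.prems by (intro insert.IH) auto
      also have "\<dots> = z * (CLINT \<omega>|M. iexp (t * X k \<omega>))"
        unfolding p z_def by (simp only: mult_ac)
      finally show "(CLINT \<omega>|M. Z \<omega> * iexp (t * X k \<omega>)) = z * (CLINT \<omega>|M. iexp (t * X k \<omega>))" .
    qed auto
    then show ?case
      using insert(1,2) by (simp add: Z_def z_def mult_ac)
  qed
  show ?thesis
  proof (cases "I = {}")
    case True
    then show ?thesis by (simp add: indep_vars_def2 indep_sets_def)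
  next
    case False
    \<comment> \<open>Checking only the full index set \<open>I\<close> suffices, since each family
      contains the whole space and unwanted factors can be set to it.\<close>
    have "indep_sets (\<lambda>i. {X i -` A \<inter> space M |A. A \<in> sets borel}) I"
    proof (subst indep_sets_finite[OF False I])
      show "\<forall>B\<in>Pi I (\<lambda>i. {X i -` A \<inter> space M |A. A \<in> sets borel}). prob (\<Inter>j\<in>I. B j) = (\<Prod>j\<in>I. prob (B j))"
      proof
        fix B assume "B \<in> Pi I (\<lambda>i. {X i -` A \<inter> space M |A. A \<in> sets borel})"
        then have "\<forall>i\<in>I. \<exists>A. A \<in> sets borel \<and> B i = X i -` A \<inter> space M"
          by (auto dest!: Pi_mem)
        then obtain A where A: "\<And>i. i \<in> I \<Longrightarrow> A i \<in> sets borel" "\<And>i. i \<in> I \<Longrightarrow> B i = X i -` A i \<inter> space M"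
          by metis
        have "(\<Prod>i\<in>I. indicator (A i) (X i \<omega>)) = (indicator (\<Inter>j\<in>I. B j) \<omega> :: complex)" if "\<omega> \<in> space M" for \<omega>
          using that I A(2) by (auto simp: indicator_def)
        then have "(CLINT \<omega>|M. indicator (\<Inter>j\<in>I. B j) \<omega>) = (CLINT \<omega>|M. (\<Prod>i\<in>I. indicator (A i) (X i \<omega>)))"
          by (intro Bochner_Integration.integral_cong) auto
        also have "\<dots> = of_real (\<Prod>j\<in>I. prob (B j))"
          using main[OF I order_refl A(1)] A(2) by simp
        finally have "(CLINT \<omega>|M. indicator (\<Inter>j\<in>I. B j) \<omega>) = of_real (\<Prod>j\<in>I. prob (B j))" .
        moreover have "(CLINT \<omega>|M. indicator (\<Inter>j\<in>I. B j) \<omega>) =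
            (CLINT \<omega>|M. of_real (indicator (\<Inter>j\<in>I. B j) \<omega>))"
          by (intro Bochner_Integration.integral_cong) (auto simp: indicator_def)
        then have "(CLINT \<omega>|M. indicator (\<Inter>j\<in>I. B j) \<omega>) = of_real (expectation (indicator (\<Inter>j\<in>I. B j)))"
          by (simp only: Bochner_Integration.integral_complex_of_real)
        moreover have "(\<Inter>j\<in>I. B j) \<subseteq> space M" using False A(2) by auto
        then have "expectation (indicator (\<Inter>j\<in>I. B j)) = prob (\<Inter>j\<in>I. B j)"
          by (subst Bochner_Integration.integral_indicator) (simp only: Int_absorb2)
        ultimately show "prob (\<Inter>j\<in>I. B j) = (\<Prod>j\<in>I. prob (B j))"
          by (simp only: of_real_eq_iff)
      qed
    qed (use X in \<open>auto intro!: exI[of _ UNIV]\<close>)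
    then show ?thesis using X by (simp add: indep_vars_def2)
  qed
qed

section \<open>A maximal inequality for moments\<close>

text \<open>Convexity of even powers, used as a pointwise substitute for the submartingale property
  of the powers of the partial sums.\<close>

lemma power_even_above_tangent:
  fixes x y :: real
  assumes "even q"
  shows "y ^ q + real q * y ^ (q - 1) * (x - y) \<le> x ^ q"
proof -
  have "((\<lambda>x. x ^ q) has_real_derivative real q * y ^ (q - 1)) (at y within UNIV)"
    by (auto intro!: derivative_eq_intros)
  then have "x ^ q - y ^ q \<ge> real q * y ^ (q - 1) * (x - y)"
    using assms by (intro convex_on_imp_above_tangent[of UNIV]) (auto intro: convex_power_even)
  then show ?thesis by simp
qed

text \<open>Doob's argument: decompose according to the first passage time \<open>k\<close> above \<open>a\<close>; the linear
  term of the tangent of \<open>x ^ q\<close> at \<open>S k\<close> has mean zero by independence.\<close>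

lemma (in prob_space) moment_maximal_inequality:
  fixes X :: "nat \<Rightarrow> 'a \<Rightarrow> real"
  defines "S \<equiv> \<lambda>k \<omega>. \<Sum>i=1..k. X i \<omega>"
  assumes indep: "indep_vars (\<lambda>_. borel) X {1..n}"
    and int: "\<And>i. i \<in> {1..n} \<Longrightarrow> integrable M (X i)" and zero: "\<And>i. i \<in> {1..n} \<Longrightarrow> expectation (X i) = 0"
    and Sint: "\<And>k. k \<le> n \<Longrightarrow> integrable M (\<lambda>\<omega>. S k \<omega> ^ q)"
    and q: "even q" "0 < q" and a: "0 < a"
  shows "prob {\<omega> \<in> space M. \<exists>k\<le>n. a \<le> \<bar>S k \<omega>\<bar>} \<le> expectation (\<lambda>\<omega>. S n \<omega> ^ q) / a ^ q"
proof -
  define P where "P k \<omega> \<longleftrightarrow> a \<le> \<bar>S k \<omega>\<bar> \<and> (\<forall>j<k. \<bar>S j \<omega>\<bar> < a)" for k \<omega>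
  define g where "g k \<omega> = (if P k \<omega> then S k \<omega> ^ (q - 1) else 0)" for k \<omega>
  have Smeas[measurable]: "S k \<in> borel_measurable M" if "k \<le> n" for k
    unfolding S_def using int that by (intro borel_measurable_sum borel_measurable_integrable) auto
  \<comment> \<open>The power \<open>q - 1\<close> is dominated through
    \<open>\<bar>x\<bar> ^ (q - 1) \<le> 1 + \<bar>x\<bar> ^ q\<close>.\<close>
  have gint: "integrable M (g k)" if k: "k \<le> n" for k
  proof (rule Bochner_Integration.integrable_bound)
    show "integrable M (\<lambda>\<omega>. 1 + S k \<omega> ^ q)" using Sint[OF k] by simp
    have [measurable]: "S j \<in> borel_measurable M" if "j \<in> {..k}" for j
      using Smeas that k by auto
    have [measurable]: "Measurable.pred M (P k)"
      unfolding P_def Ball_def[symmetric] lessThan_iff[symmetric] by measurable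
    show "g k \<in> borel_measurable M" unfolding g_def by measurable
    show "AE \<omega> in M. norm (g k \<omega>) \<le> norm (1 + S k \<omega> ^ q)"
    proof (rule AE_I2)
      fix \<omega>
      have "\<bar>S k \<omega>\<bar> ^ (q - 1) \<le> 1 + \<bar>S k \<omega>\<bar> ^ q"
      proof (cases "\<bar>S k \<omega>\<bar> \<le> 1")
        case True
        then have "\<bar>S k \<omega>\<bar> ^ (q - 1) \<le> 1" by (intro power_le_one) auto
        then show ?thesis by (smt (verit) zero_le_power abs_ge_zero)
      next
        case False
        then have "\<bar>S k \<omega>\<bar> ^ (q - 1) \<le> \<bar>S k \<omega>\<bar> ^ q" by (intro power_increasing) auto
        then show ?thesis by simp
      qed
      moreover have "\<bar>S k \<omega>\<bar> ^ q = S k \<omega> ^ q" "0 \<le> S k \<omega> ^ q"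
        using q by (auto simp: power_even_abs zero_le_even_power)
      ultimately show "norm (g k \<omega>) \<le> norm (1 + S k \<omega> ^ q)"
        by (auto simp: g_def power_abs)
    qed
  qed
  have orth: "integrable M (\<lambda>\<omega>. g k \<omega> * (S n \<omega> - S k \<omega>)) \<and> expectation (\<lambda>\<omega>. g k \<omega> * (S n \<omega> - S k \<omega>)) = 0"
    if k: "k \<le> n" for k
  proof -
    define T where "T \<omega> = (\<Sum>i\<in>{k + 1..n}. X i \<omega>)" for \<omega>
    have T: "S n \<omega> - S k \<omega> = T \<omega>" for \<omega>
    proof -
      have "{1..n} = {1..k} \<union> {k + 1..n}" using k by auto
      then have "S n \<omega> = S k \<omega> + T \<omega>"
        unfolding S_def T_def by (simp only:) (intro sum.union_disjoint, auto)
      then show ?thesis by simp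
    qed
    \<comment> \<open>\<open>g k\<close> written as a measurable function of the first
      \<open>k\<close> coordinates, so that independence from the later block, whose sum is
      \<open>T\<close>, applies.\<close>
    define G where "G x = (if a \<le> \<bar>\<Sum>i=1..k. x i\<bar> \<and> (\<forall>j\<in>{..<k}. \<bar>\<Sum>i=1..j. x i\<bar> < a)
      then (\<Sum>i=1..k. x i) ^ (q - 1) else 0)" for x :: "nat \<Rightarrow> real"
    have [measurable]: "(\<lambda>x::nat \<Rightarrow> real. \<Sum>i=1..j. x i) \<in> borel_measurable (PiM {1..k} (\<lambda>_. borel))" if "j \<in> {..k}" for j
      using that by (intro borel_measurable_sum[where f = "\<lambda>i x. x i"] measurable_component_singleton) auto
    have "G \<in> borel_measurable (PiM {1..k} (\<lambda>_. borel))"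
      unfolding G_def by measurable
    moreover have "(\<lambda>x::nat \<Rightarrow> real. \<Sum>i\<in>{k + 1..n}. x i) \<in> borel_measurable (PiM {k + 1..n} (\<lambda>_. borel))"
      by (intro borel_measurable_sum[where f = "\<lambda>i x. x i"] measurable_component_singleton) auto
    ultimately have "indep_var borel (G \<circ> (\<lambda>\<omega>. restrict (\<lambda>i. X i \<omega>) {1..k}))
        borel ((\<lambda>x. \<Sum>i\<in>{k + 1..n}. x i) \<circ> (\<lambda>\<omega>. restrict (\<lambda>i. X i \<omega>) {k + 1..n}))"
      using k by (intro indep_var_compose[OF indep_var_restrict[OF indep]]) auto
    moreover have "G \<circ> (\<lambda>\<omega>. restrict (\<lambda>i. X i \<omega>) {1..k}) = g k"
      by (auto simp: fun_eq_iff G_def g_def P_def S_def)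
    moreover have "(\<lambda>x. \<Sum>i\<in>{k + 1..n}. x i) \<circ> (\<lambda>\<omega>. restrict (\<lambda>i. X i \<omega>) {k + 1..n}) = T"
      by (auto simp: fun_eq_iff T_def)
    ultimately have ind: "indep_var borel (g k) borel T" by simp
    have Ti: "integrable M T" unfolding T_def using int by (intro Bochner_Integration.integrable_sum) auto
    have "expectation T = 0"
      unfolding T_def using int zero by (subst Bochner_Integration.integral_sum) auto
    then show ?thesis
      unfolding T using indep_var_lebesgue_integral[OF ind gint[OF k] Ti] indep_var_integrable[OF ind gint[OF k] Ti] by simp
  qed
  let ?E = "{\<omega> \<in> space M. \<exists>k\<le>n. a \<le> \<bar>S k \<omega>\<bar>}"
  have [measurable]: "?E \<in> sets M"
  proof -
    have "?E = (\<Union>k\<in>{..n}. {\<omega> \<in> space M. a \<le> \<bar>S k \<omega>\<bar>})" by auto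
    also have "\<dots> \<in> sets M"
    proof (intro sets.finite_UN)
      fix k assume "k \<in> {..n}"
      then have [measurable]: "S k \<in> borel_measurable M" using Smeas by auto
      show "{\<omega> \<in> space M. a \<le> \<bar>S k \<omega>\<bar>} \<in> sets M" by measurable
    qed simp
    finally show ?thesis .
  qed
  \<comment> \<open>On the event only the first passage index contributes to the sum, which leaves
    the tangent inequality; off the event all \<open>g k\<close> vanish and
    \<open>S n \<omega> ^ q\<close> is nonnegative.\<close>
  have pw: "a ^ q * indicator ?E \<omega> \<le> S n \<omega> ^ q - real q * (\<Sum>k\<le>n. g k \<omega> * (S n \<omega> - S k \<omega>))"
    if \<omega>: "\<omega> \<in> space M" for \<omega>
  proof (cases "\<omega> \<in> ?E")
    case True
    define \<kappa> where "\<kappa> = (LEAST k. a \<le> \<bar>S k \<omega>\<bar>)"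
    from True obtain k0 where k0: "k0 \<le> n" "a \<le> \<bar>S k0 \<omega>\<bar>" by auto
    have \<kappa>: "a \<le> \<bar>S \<kappa> \<omega>\<bar>" "\<kappa> \<le> n"
      using k0 unfolding \<kappa>_def by (auto intro: LeastI order_trans[OF Least_le])
    have "\<forall>j<\<kappa>. \<bar>S j \<omega>\<bar> < a" unfolding \<kappa>_def by (auto dest!: not_less_Least)
    then have P: "P k \<omega> \<longleftrightarrow> k = \<kappa>" for k
      unfolding P_def using \<kappa>(1) by (metis linorder_neqE_nat not_less)
    have "(\<Sum>k\<le>n. g k \<omega> * (S n \<omega> - S k \<omega>)) = (\<Sum>k\<le>n. if k = \<kappa> then S \<kappa> \<omega> ^ (q - 1) * (S n \<omega> - S \<kappa> \<omega>) else 0)"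
      by (intro sum.cong) (auto simp: g_def P)
    also have "\<dots> = S \<kappa> \<omega> ^ (q - 1) * (S n \<omega> - S \<kappa> \<omega>)" using \<kappa>(2) by simp
    finally have s: "(\<Sum>k\<le>n. g k \<omega> * (S n \<omega> - S k \<omega>)) = S \<kappa> \<omega> ^ (q - 1) * (S n \<omega> - S \<kappa> \<omega>)" .
    have "a ^ q \<le> \<bar>S \<kappa> \<omega>\<bar> ^ q" using a \<kappa>(1) by (intro power_mono) auto
    also have "\<dots> = S \<kappa> \<omega> ^ q" using q by (simp add: power_even_abs)
    finally show ?thesis
      using power_even_above_tangent[OF q(1), of "S \<kappa> \<omega>" "S n \<omega>"] True unfolding s by (simp add: mult.assoc)
  next
    case False
    then have "g k \<omega> = 0" if "k \<le> n" for k using \<omega> that by (auto simp: g_def P_def)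
    then have "(\<Sum>k\<le>n. g k \<omega> * (S n \<omega> - S k \<omega>)) = 0" by (intro sum.neutral) auto
    then show ?thesis using False q by (simp add: zero_le_even_power)
  qed
  have "a ^ q * prob ?E = expectation (\<lambda>\<omega>. a ^ q * indicator ?E \<omega>)"
    by simp
  also have "\<dots> \<le> expectation (\<lambda>\<omega>. S n \<omega> ^ q - real q * (\<Sum>k\<le>n. g k \<omega> * (S n \<omega> - S k \<omega>)))"
  proof (intro integral_mono pw)
    show "integrable M (\<lambda>\<omega>. a ^ q * indicator ?E \<omega>)"
      by (intro integrable_mult_right integrable_real_indicator) (auto simp: less_top[symmetric])
    show "integrable M (\<lambda>\<omega>. S n \<omega> ^ q - real q * (\<Sum>k\<le>n. g k \<omega> * (S n \<omega> - S k \<omega>)))"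
      using orth Sint by (intro Bochner_Integration.integrable_diff integrable_mult_right Bochner_Integration.integrable_sum) auto
  qed
  also have "\<dots> = expectation (\<lambda>\<omega>. S n \<omega> ^ q)"
    using orth Sint by (subst Bochner_Integration.integral_diff) (auto simp: Bochner_Integration.integral_sum)
  finally show ?thesis using a by (simp add: field_simps)
qed

section \<open>Centred Gaussian variables\<close>

lemma cmod_iexp_diff_le: "cmod (iexp x - iexp y) \<le> \<bar>x - y\<bar>"
proof -
  have "iexp x - iexp y = iexp y * (iexp (x - y) - 1)"
    by (simp add: exp_diff right_diff_distrib)
  then show ?thesis
    using iexp_approx1[of "x - y" 0] by (simp add: norm_mult)
qed

lemma exp_minus_lipschitz:
  fixes a b :: real
  assumes "0 \<le> a" "0 \<le> b"
  shows "\<bar>exp (- a) - exp (- b)\<bar> \<le> \<bar>a - b\<bar>"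
  using assms
proof (induction a b rule: linorder_wlog)
  case (le a b)
  have "1 - exp (- (b - a)) \<le> b - a"
    using exp_ge_add_one_self[of "- (b - a)"] by linarith
  then have "exp (- a) * (1 - exp (- (b - a))) \<le> 1 * (b - a)"
    using le by (intro mult_mono) auto
  moreover have "exp (- a) * (1 - exp (- (b - a))) = exp (- a) - exp (- b)"
    by (simp add: right_diff_distrib exp_diff exp_minus field_simps)
  ultimately show ?case using le by simp
qed (simp add: abs_minus_commute)

lemma (in prob_space) std_normal_of_gaussian_law:
  assumes [measurable]: "random_variable borel X"
    and law: "distr M borel X = gaussian_law \<mu> \<sigma>" and "0 < \<sigma>"
  shows "distr M borel (\<lambda>\<omega>. (X \<omega> - \<mu>) / \<sigma>) = std_normal_distribution"
proof -
  have "distr M lborel X = density lborel (normal_density \<mu> \<sigma>)"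
    using law \<open>0 < \<sigma>\<close> by (simp add: gaussian_law_def cong: distr_cong)
  then have "distributed M lborel X (normal_density \<mu> \<sigma>)"
    by (simp add: distributed_def)
  then have "distributed M lborel (\<lambda>\<omega>. (X \<omega> - \<mu>) / \<sigma>) std_normal_density"
    using normal_standard_normal_convert[OF \<open>0 < \<sigma>\<close>] by blast
  then show ?thesis
    by (simp add: distributed_def cong: distr_cong)
qed

lemma (in prob_space) std_normal_moments:
  assumes [measurable]: "random_variable borel Y" and law: "distr M borel Y = std_normal_distribution"
  shows "integrable M (\<lambda>\<omega>. Y \<omega> ^ k)"
    and "expectation (\<lambda>\<omega>. Y \<omega> ^ k) = (LINT x|std_normal_distribution. x ^ k)"
    and "(CLINT \<omega>|M. iexp (t * Y \<omega>)) = exp (- (t\<^sup>2) / 2)"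
proof -
  have "integrable (distr M borel Y) (\<lambda>x. x ^ k)"
    unfolding law by (rule integrable_std_normal_distribution_moment)
  then show "integrable M (\<lambda>\<omega>. Y \<omega> ^ k)"
    by (simp add: integrable_distr_eq)
  show "expectation (\<lambda>\<omega>. Y \<omega> ^ k) = (LINT x|std_normal_distribution. x ^ k)"
    by (simp add: law[symmetric] integral_distr)
  have "char (distr M borel Y) t = exp (- (t\<^sup>2) / 2)"
    unfolding law by (simp add: char_std_normal_distribution)
  then show "(CLINT \<omega>|M. iexp (t * Y \<omega>)) = exp (- (t\<^sup>2) / 2)"
    by (simp add: char_def integral_distr)
qed

text \<open>A Dirac law makes \<open>X\<close> almost surely constant; otherwise
  \<open>X = \<mu> + \<sigma> * Y\<close> with \<open>Y\<close> standard normal. In both cases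
  \<open>expectation X = \<mu>\<close>, so centring forces \<open>\<mu> = 0\<close>.\<close>

lemma (in prob_space) centred_gaussian_char:
  assumes X[measurable]: "random_variable borel X"
    and law: "distr M borel X = gaussian_law \<mu> \<sigma>" and \<sigma>: "0 \<le> \<sigma>"
  shows "integrable M X" and "integrable M (\<lambda>\<omega>. (X \<omega>)\<^sup>2)"
    and "expectation X = 0 \<Longrightarrow> (CLINT \<omega>|M. iexp (X \<omega>)) = exp (- expectation (\<lambda>\<omega>. (X \<omega>)\<^sup>2) / 2)"
proof -
  have "integrable M X \<and> integrable M (\<lambda>\<omega>. (X \<omega>)\<^sup>2) \<and>
    (expectation X = 0 \<longrightarrow> (CLINT \<omega>|M. iexp (X \<omega>)) = exp (- expectation (\<lambda>\<omega>. (X \<omega>)\<^sup>2) / 2))"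
  proof (cases "\<sigma> = 0")
    case True
    then have "distr M borel X = return borel \<mu>"
      by (simp add: law gaussian_law_def)
    moreover have "AE x in return borel \<mu>. x = \<mu>"
      by (subst AE_return) auto
    ultimately have "AE x in distr M borel X. x = \<mu>"
      by (simp only:)
    then have ae: "AE \<omega> in M. X \<omega> = \<mu>" by (simp add: AE_distr_iff)
    have int: "integrable M X" "integrable M (\<lambda>\<omega>. (X \<omega>)\<^sup>2)"
      by (rule integrable_const_bound[of _ "\<bar>\<mu>\<bar>"], use ae in auto)
        (rule integrable_const_bound[of _ "\<mu>\<^sup>2"], use ae in auto)
    have "expectation X = \<mu>"
      using integral_cong_AE[OF _ _ ae] by (simp add: prob_space)
    moreover have "expectation (\<lambda>\<omega>. (X \<omega>)\<^sup>2) = expectation (\<lambda>_. \<mu>\<^sup>2)"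
      using ae by (intro integral_cong_AE) auto
    moreover have "(CLINT \<omega>|M. iexp (X \<omega>)) = (CLINT \<omega>|M. iexp \<mu>)"
      using ae by (intro integral_cong_AE) auto
    ultimately show ?thesis using int by (auto simp: prob_space)
  next
    case False
    define Y where "Y \<omega> = (X \<omega> - \<mu>) / \<sigma>" for \<omega>
    have [measurable]: "random_variable borel Y" unfolding Y_def by simp
    have "distr M borel Y = std_normal_distribution"
      using std_normal_of_gaussian_law[OF X law] False \<sigma> unfolding Y_def by simp
    note Y = std_normal_moments[OF _ this, simplified]
    have int[simp]: "integrable M Y" "integrable M (\<lambda>\<omega>. (Y \<omega>)\<^sup>2)"
      using Y(1)[of 1] Y(1)[of 2] by simp_all
    have E: "expectation Y = 0" "expectation (\<lambda>\<omega>. (Y \<omega>)\<^sup>2) = 1"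
      using Y(2)[of 1] Y(2)[of 2] integral_std_normal_distribution_moment_odd[of 1]
        std_normal_distribution_even_moments(1)[of 1] by (simp_all add: numeral_2_eq_2)
    have X_eq: "X = (\<lambda>\<omega>. \<mu> + \<sigma> * Y \<omega>)"
      using False by (auto simp: Y_def fun_eq_iff)
    have sq: "(\<mu> + \<sigma> * Y \<omega>)\<^sup>2 = \<mu>\<^sup>2 + 2 * \<mu> * \<sigma> * Y \<omega> + \<sigma>\<^sup>2 * (Y \<omega>)\<^sup>2" for \<omega>
      by (simp add: power2_sum power_mult_distrib)
    have "expectation (\<lambda>\<omega>. \<mu> + \<sigma> * Y \<omega>) = \<mu>"
      using E by (simp add: prob_space)
    moreover have "expectation (\<lambda>\<omega>. (\<mu> + \<sigma> * Y \<omega>)\<^sup>2) = \<mu>\<^sup>2 + \<sigma>\<^sup>2"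
      unfolding sq using E by (simp add: prob_space)
    ultimately show ?thesis
      unfolding X_eq using Y(3)[of \<sigma>] E by (auto simp: sq power_mult_distrib)
  qed
  then show "integrable M X" "integrable M (\<lambda>\<omega>. (X \<omega>)\<^sup>2)"
    "expectation X = 0 \<Longrightarrow> (CLINT \<omega>|M. iexp (X \<omega>)) = exp (- expectation (\<lambda>\<omega>. (X \<omega>)\<^sup>2) / 2)"
    by auto
qed

text \<open>A centred Gaussian characteristic function is determined by the second moment, and both
  sides of the identity are continuous in \<open>L\<^sup>2\<close>.\<close>

lemma (in prob_space) gaussian_space_char:
  assumes B: "gaussian_process M B" and mean: "\<And>t. t \<in> {0..1} \<Longrightarrow> expectation (B t) = 0"
    and X: "X \<in> gaussian_space M B"
  shows "(CLINT \<omega>|M. iexp (X \<omega>)) = exp (- expectation (\<lambda>\<omega>. (X \<omega>)\<^sup>2) / 2)"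
proof -
  have Xm[measurable]: "X \<in> borel_measurable M" and X2[simp]: "integrable M (\<lambda>\<omega>. (X \<omega>)\<^sup>2)"
    using X by (auto simp: gaussian_space_def L2_space_def)
  have Bm: "B t \<in> borel_measurable M" if "t \<in> {0..1}" for t
    using B that by (simp add: gaussian_process_def)
  have law: "\<exists>\<mu> \<sigma>. 0 \<le> \<sigma> \<and> distr M borel (\<lambda>\<omega>. \<Sum>t\<in>T. c t * B t \<omega>) = gaussian_law \<mu> \<sigma>"
    if "finite T" "T \<subseteq> {0..1}" for T c
    using B that by (simp add: gaussian_process_def)
  have Bi: "integrable M (B t)" if "t \<in> {0..1}" for t
    using law[of "{t}" "\<lambda>_. 1"] that Bm[OF that] by (auto dest: centred_gaussian_char(1)[rotated])
  let ?v = "expectation (\<lambda>\<omega>. (X \<omega>)\<^sup>2)"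
  \<comment> \<open>\<open>X\<close> is approximated by a finite combination \<open>Y\<close> within
    \<open>e\<close> in mean square. In the factor \<open>3 + ?v\<close>, 1 comes from exchanging
    \<open>X\<close> and \<open>Y\<close> under the exponential and \<open>2 + ?v\<close> from
    exchanging their second moments; \<open>e \<le> 1\<close> absorbs a term
    \<open>e * e\<close>.\<close>
  have le: "cmod ((CLINT \<omega>|M. iexp (X \<omega>)) - exp (- ?v / 2)) \<le> e * (3 + ?v)" if e: "0 < e" "e \<le> 1" for e
  proof -
    obtain T c where T: "finite T" "T \<subseteq> {0..1}" and close: "expectation (\<lambda>\<omega>. (X \<omega> - (\<Sum>t\<in>T. c t * B t \<omega>))\<^sup>2) < e\<^sup>2"
      using X e unfolding gaussian_space_def by (auto dest!: spec[of _ "e\<^sup>2"])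
    define Y where "Y \<omega> = (\<Sum>t\<in>T. c t * B t \<omega>)" for \<omega>
    have Ym[measurable]: "Y \<in> borel_measurable M"
      unfolding Y_def using Bm T by (intro borel_measurable_sum borel_measurable_times) auto
    obtain \<mu> \<sigma> where gl: "distr M borel Y = gaussian_law \<mu> \<sigma>" "0 \<le> \<sigma>"
      using law[OF T, of c] unfolding Y_def by blast
    have "expectation Y = 0"
      unfolding Y_def using T Bi mean by (subst Bochner_Integration.integral_sum) (auto intro!: sum.neutral)
    note Y = centred_gaussian_char(1,2)[OF Ym gl] centred_gaussian_char(3)[OF Ym gl this]
    have [simp]: "integrable M Y" "integrable M (\<lambda>\<omega>. (Y \<omega>)\<^sup>2)" using Y by auto
    have [simp]: "integrable M X"
      using X2 by (rule square_integrable_imp_integrable[OF Xm])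
    define D where "D \<omega> = X \<omega> - Y \<omega>" for \<omega>
    have [measurable]: "D \<in> borel_measurable M" unfolding D_def by simp
    have "integrable M (\<lambda>\<omega>. 2 * ((X \<omega>)\<^sup>2 + (Y \<omega>)\<^sup>2))" by simp
    then have D2[simp]: "integrable M (\<lambda>\<omega>. (D \<omega>)\<^sup>2)"
    proof (rule Bochner_Integration.integrable_bound)
      have "(D \<omega>)\<^sup>2 \<le> 2 * ((X \<omega>)\<^sup>2 + (Y \<omega>)\<^sup>2)" for \<omega>
        using sum_power2_ge_zero[of "X \<omega> + Y \<omega>" 0] by (simp add: D_def power2_eq_square algebra_simps)
      then show "AE \<omega> in M. norm ((D \<omega>)\<^sup>2) \<le> norm (2 * ((X \<omega>)\<^sup>2 + (Y \<omega>)\<^sup>2))" by simp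
    qed simp
    have D2e: "expectation (\<lambda>\<omega>. (D \<omega>)\<^sup>2) \<le> e\<^sup>2"
      using close by (simp add: D_def Y_def)
    have [simp]: "integrable M D" unfolding D_def by simp
    \<comment> \<open>A weighted arithmetic-geometric mean bound takes the place of Cauchy-Schwarz:
      the mean of \<open>(D \<omega>)\<^sup>2\<close> is at most \<open>e\<^sup>2\<close>, so that
      of \<open>\<bar>D \<omega>\<bar>\<close> is at most \<open>e\<close>.\<close>
    have amgm: "\<bar>D \<omega>\<bar> \<le> (e + (D \<omega>)\<^sup>2 / e) / 2" for \<omega>
      using sum_power2_ge_zero[of "\<bar>D \<omega>\<bar> - e" 0] e by (simp add: field_simps power2_eq_square)
    have "expectation (\<lambda>\<omega>. \<bar>D \<omega>\<bar>) \<le> expectation (\<lambda>\<omega>. (e + (D \<omega>)\<^sup>2 / e) / 2)"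
      using amgm by (intro integral_mono) auto
    also have "\<dots> = (e + expectation (\<lambda>\<omega>. (D \<omega>)\<^sup>2) / e) / 2" by (simp add: prob_space)
    also have "\<dots> \<le> (e + e\<^sup>2 / e) / 2"
      using D2e e by (intro divide_right_mono add_left_mono) auto
    also have "\<dots> = e" using e by (simp add: power2_eq_square)
    finally have D1: "expectation (\<lambda>\<omega>. \<bar>D \<omega>\<bar>) \<le> e" .
    have [simp]: "integrable M (\<lambda>\<omega>. iexp (X \<omega>))" "integrable M (\<lambda>\<omega>. iexp (Y \<omega>))"
      by (auto intro!: integrable_const_bound[of _ 1])
    have "cmod ((CLINT \<omega>|M. iexp (X \<omega>)) - (CLINT \<omega>|M. iexp (Y \<omega>))) = cmod (CLINT \<omega>|M. iexp (X \<omega>) - iexp (Y \<omega>))"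
      by simp
    also have "\<dots> \<le> expectation (\<lambda>\<omega>. cmod (iexp (X \<omega>) - iexp (Y \<omega>)))"
      by (rule integral_norm_bound)
    also have "\<dots> \<le> expectation (\<lambda>\<omega>. \<bar>D \<omega>\<bar>)"
      unfolding D_def by (intro integral_mono cmod_iexp_diff_le) auto
    finally have 1: "cmod ((CLINT \<omega>|M. iexp (X \<omega>)) - (CLINT \<omega>|M. iexp (Y \<omega>))) \<le> e"
      using D1 by simp
    let ?w = "expectation (\<lambda>\<omega>. (Y \<omega>)\<^sup>2)"
    \<comment> \<open>The cross term is split with weights \<open>e\<close> and
      \<open>1 / e\<close>, so that both parts have expectation of order \<open>e\<close>.\<close>
    have pw: "\<bar>(X \<omega>)\<^sup>2 - (Y \<omega>)\<^sup>2\<bar> \<le> e * (X \<omega>)\<^sup>2 + (1 / e + 1) * (D \<omega>)\<^sup>2" for \<omega>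
    proof -
      have "(X \<omega>)\<^sup>2 - (Y \<omega>)\<^sup>2 = 2 * X \<omega> * D \<omega> - (D \<omega>)\<^sup>2"
        by (simp add: D_def power2_eq_square algebra_simps)
      moreover have "\<bar>2 * X \<omega> * D \<omega>\<bar> \<le> e * (X \<omega>)\<^sup>2 + (D \<omega>)\<^sup>2 / e"
        using sum_power2_ge_zero[of "e * \<bar>X \<omega>\<bar> - \<bar>D \<omega>\<bar>" 0] e
        by (simp add: field_simps power2_eq_square abs_mult)
      moreover have "(1 / e + 1) * (D \<omega>)\<^sup>2 = (D \<omega>)\<^sup>2 / e + (D \<omega>)\<^sup>2"
        by (simp add: field_simps)
      moreover have "0 \<le> (D \<omega>)\<^sup>2" by simp
      ultimately show ?thesis by linarith
    qed
    have "\<bar>?v - ?w\<bar> = \<bar>expectation (\<lambda>\<omega>. (X \<omega>)\<^sup>2 - (Y \<omega>)\<^sup>2)\<bar>" by simp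
    also have "\<dots> \<le> expectation (\<lambda>\<omega>. \<bar>(X \<omega>)\<^sup>2 - (Y \<omega>)\<^sup>2\<bar>)" by (rule integral_abs_bound)
    also have "\<dots> \<le> expectation (\<lambda>\<omega>. e * (X \<omega>)\<^sup>2 + (1 / e + 1) * (D \<omega>)\<^sup>2)"
      by (intro integral_mono pw integrable_abs Bochner_Integration.integrable_diff
          Bochner_Integration.integrable_add integrable_mult_right) auto
    also have "\<dots> = e * ?v + (1 / e + 1) * expectation (\<lambda>\<omega>. (D \<omega>)\<^sup>2)"
      by simp
    also have "\<dots> \<le> e * ?v + (1 / e + 1) * e\<^sup>2"
      using D2e e by (intro add_left_mono mult_left_mono) auto
    also have "\<dots> = e * ?v + e + e * e"
      using e by (simp add: field_simps power2_eq_square)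
    also have "\<dots> \<le> e * ?v + e + e * 1"
      using e by (intro add_left_mono mult_left_mono) auto
    finally have 2: "\<bar>?v - ?w\<bar> \<le> e * (2 + ?v)" by (simp add: algebra_simps)
    have "0 \<le> ?v" "0 \<le> ?w" by (auto intro!: integral_nonneg_AE)
    then have "\<bar>exp (- (?w / 2)) - exp (- (?v / 2))\<bar> \<le> \<bar>?w / 2 - ?v / 2\<bar>"
      by (intro exp_minus_lipschitz) auto
    also have "\<dots> \<le> \<bar>?v - ?w\<bar>" by (simp add: abs_if)
    finally have 3: "cmod (exp (- ?w / 2) - exp (- ?v / 2)) \<le> \<bar>?v - ?w\<bar>"
      by (simp only: of_real_diff[symmetric] norm_of_real minus_divide_left)
    have "cmod ((CLINT \<omega>|M. iexp (X \<omega>)) - exp (- ?v / 2)) \<le>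
        cmod ((CLINT \<omega>|M. iexp (X \<omega>)) - (CLINT \<omega>|M. iexp (Y \<omega>))) + cmod ((CLINT \<omega>|M. iexp (Y \<omega>)) - exp (- ?v / 2))"
      by (rule norm_diff_triangle_le[OF order_refl order_refl])
    also have "\<dots> \<le> e + e * (2 + ?v)"
      using 1 order_trans[OF 3 2] unfolding Y(3) of_real_diff by (rule add_mono)
    finally show ?thesis by (simp add: algebra_simps)
  qed
  have "((\<lambda>e. e * (3 + ?v)) \<longlongrightarrow> 0 * (3 + ?v)) (at_right 0)"
    by (intro tendsto_intros)
  moreover have "\<forall>\<^sub>F e in at_right (0::real). cmod ((CLINT \<omega>|M. iexp (X \<omega>)) - exp (- ?v / 2)) \<le> e * (3 + ?v)"
    using le by (auto simp: eventually_at_right_field intro!: exI[of _ 1])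
  ultimately have "cmod ((CLINT \<omega>|M. iexp (X \<omega>)) - exp (- ?v / 2)) \<le> 0"
    by (intro tendsto_lowerbound[where F = "at_right (0::real)"]) auto
  then show ?thesis by simp
qed

section \<open>Isonormal processes\<close>

definition fourier_sum :: "(nat \<Rightarrow> 'h::real_inner) \<Rightarrow> nat \<Rightarrow> 'h \<Rightarrow> 'h" where
  "fourier_sum \<phi> N h = (\<Sum>n=1..N. inner (\<phi> n) h *\<^sub>R \<phi> n)"

lemma fourier_sum_diff: "fourier_sum \<phi> N (h - k) = fourier_sum \<phi> N h - fourier_sum \<phi> N k"
  by (simp add: fourier_sum_def inner_diff_right scaleR_left_diff_distrib sum_subtractf)

lemma orthonormal_norm_sum:
  assumes "\<And>m n. m \<in> I \<Longrightarrow> n \<in> I \<Longrightarrow> inner (\<phi> m) (\<phi> n) = (if m = n then 1 else 0::real)" "finite I"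
  shows "(norm (\<Sum>n\<in>I. c n *\<^sub>R \<phi> n))\<^sup>2 = (\<Sum>n\<in>I. (c n)\<^sup>2)"
proof -
  have "inner (\<Sum>n\<in>I. c n *\<^sub>R \<phi> n) (\<Sum>n\<in>I. c n *\<^sub>R \<phi> n) = (\<Sum>m\<in>I. \<Sum>n\<in>I. c m * (c n * inner (\<phi> n) (\<phi> m)))"
    by (simp add: inner_sum_left inner_sum_right sum_distrib_left)
  also have "\<dots> = (\<Sum>m\<in>I. \<Sum>n\<in>I. if n = m then (c m)\<^sup>2 else 0)"
    by (intro sum.cong refl) (auto simp: assms(1) power2_eq_square)
  also have "\<dots> = (\<Sum>n\<in>I. (c n)\<^sup>2)"
    using assms(2) by simp
  finally show ?thesis by (simp add: power2_norm_eq_inner)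
qed

text \<open>Bessel's inequality: the squared norm of the Fourier sum equals its inner product with
  \<open>h\<close>, to which Cauchy-Schwarz applies.\<close>

lemma norm_fourier_sum_le:
  assumes "orthonormal_basis_seq \<phi>"
  shows "norm (fourier_sum \<phi> N h) \<le> norm h"
proof -
  have sq: "(norm (fourier_sum \<phi> N h))\<^sup>2 = (\<Sum>n=1..N. (inner (\<phi> n) h)\<^sup>2)"
    unfolding fourier_sum_def using assms
    by (intro orthonormal_norm_sum) (auto simp: orthonormal_basis_seq_def)
  also have "\<dots> = inner (fourier_sum \<phi> N h) h"
    by (simp add: fourier_sum_def inner_sum_left power2_eq_square)
  also have "\<dots> \<le> norm (fourier_sum \<phi> N h) * norm h"
    by (rule norm_cauchy_schwarz)
  finally show ?thesis
    by (cases "fourier_sum \<phi> N h = 0") (auto simp: power2_eq_square)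
qed

text \<open>On the span the Fourier sums are eventually exact; being contractions, they carry the
  convergence over to the closure.\<close>

lemma fourier_sum_tendsto:
  assumes \<phi>: "orthonormal_basis_seq \<phi>"
  shows "(\<lambda>N. fourier_sum \<phi> N h) \<longlonglongrightarrow> h"
proof -
  have ev: "\<forall>\<^sub>F N in sequentially. fourier_sum \<phi> N v = v" if "v \<in> span (\<phi> ` {1..})" for v
    using that
  proof (induction rule: span_induct_alt)
    case base
    then show ?case by (simp add: fourier_sum_def)
  next
    case (step c x y)
    then obtain m where m: "1 \<le> m" "x = \<phi> m" by auto
    have "fourier_sum \<phi> N x = x" if "N \<ge> m" for N
    proof -
      have "fourier_sum \<phi> N x = (\<Sum>n=1..N. if n = m then \<phi> m else 0)"
        unfolding fourier_sum_def using \<phi> m by (intro sum.cong) (auto simp: orthonormal_basis_seq_def)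
      then show ?thesis using that m by simp
    qed
    then have "\<forall>\<^sub>F N in sequentially. fourier_sum \<phi> N x = x"
      by (auto simp: eventually_sequentially)
    then show ?case using step.IH
    proof eventually_elim
      case (elim N)
      have "fourier_sum \<phi> N (c *\<^sub>R x + y) = c *\<^sub>R fourier_sum \<phi> N x + fourier_sum \<phi> N y"
        by (simp add: fourier_sum_def inner_add_right scaleR_add_left sum.distrib scaleR_sum_right)
      then show ?case using elim by simp
    qed
  qed
  show ?thesis
  proof (rule tendstoI)
    fix e :: real assume "0 < e"
    moreover have "h \<in> closure (span (\<phi> ` {1..}))"
      using \<phi> by (simp add: orthonormal_basis_seq_def)
    ultimately obtain v where v: "v \<in> span (\<phi> ` {1..})" "dist v h < e / 2"
      unfolding closure_approachable by (meson half_gt_zero)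
    show "\<forall>\<^sub>F N in sequentially. dist (fourier_sum \<phi> N h) h < e"
      using ev[OF v(1)]
    proof eventually_elim
      case (elim N)
      have "fourier_sum \<phi> N h - h = (v - h) - fourier_sum \<phi> N (v - h)"
        using elim by (simp add: fourier_sum_diff)
      then have "norm (fourier_sum \<phi> N h - h) \<le> norm (v - h) + norm (fourier_sum \<phi> N (v - h))"
        by (metis norm_triangle_ineq4)
      with norm_fourier_sum_le[OF \<phi>, of N "v - h"] v(2) show ?case
        by (simp add: dist_norm)
    qed
  qed
qed

text \<open>Linearity holds only off a null set that depends on the arguments. Together with
  \<open>W_char\<close>, which makes each \<open>W h\<close> centred Gaussian with variance
  \<open>(norm h)\<^sup>2\<close>, it encodes joint Gaussianity.\<close>

locale isonormal_process = prob_space M for M :: "'w measure" +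
  fixes W :: "'h::{real_inner, complete_space} \<Rightarrow> 'w \<Rightarrow> real"
  assumes W_measurable[measurable]: "\<And>h. W h \<in> borel_measurable M"
    and W_linear: "\<And>a b h k. AE \<omega> in M. W (a *\<^sub>R h + b *\<^sub>R k) \<omega> = a * W h \<omega> + b * W k \<omega>"
    and W_char: "\<And>h. (CLINT \<omega>|M. iexp (W h \<omega>)) = exp (- (norm h)\<^sup>2 / 2)"
begin

section \<open>Moments and independence in an isonormal process\<close>

lemma W_scale: "AE \<omega> in M. W (a *\<^sub>R h) \<omega> = a * W h \<omega>"
  using W_linear[of a h 0 h] by simp

lemma W_diff: "AE \<omega> in M. W (h - k) \<omega> = W h \<omega> - W k \<omega>"
  using W_linear[of 1 h "-1" k] by simp

lemma W_sum:
  assumes "finite I"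
  shows "AE \<omega> in M. W (\<Sum>i\<in>I. c i *\<^sub>R h i) \<omega> = (\<Sum>i\<in>I. c i * W (h i) \<omega>)"
  using assms
proof (induction I rule: finite_induct)
  case empty
  show ?case using W_scale[of 0 0] by simp
next
  case (insert i I)
  have "AE \<omega> in M. W (c i *\<^sub>R h i + 1 *\<^sub>R (\<Sum>i\<in>I. c i *\<^sub>R h i)) \<omega> = c i * W (h i) \<omega> + 1 * W (\<Sum>i\<in>I. c i *\<^sub>R h i) \<omega>"
    by (rule W_linear)
  with insert.IH show ?case
    by eventually_elim (use insert(1,2) in simp)
qed

lemma char_scaled: "(CLINT \<omega>|M. iexp (t * W h \<omega>)) = exp (- (t * norm h)\<^sup>2 / 2)"
proof -
  have "(CLINT \<omega>|M. iexp (t * W h \<omega>)) = (CLINT \<omega>|M. iexp (W (t *\<^sub>R h) \<omega>))"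
    using W_scale[of t h] by (intro integral_cong_AE) auto
  then show ?thesis by (simp add: W_char power_mult_distrib)
qed

lemma std_normal_W:
  assumes "norm h = 1"
  shows "distr M borel (W h) = std_normal_distribution"
proof (rule Levy_uniqueness)
  show "char (distr M borel (W h)) = char std_normal_distribution"
    using assms by (simp add: fun_eq_iff char_def[of "distr _ _ _"] integral_distr char_scaled char_std_normal_distribution del: of_real_mult)
qed (auto intro: real_distribution_distr real_dist_normal_dist)

lemma W_moments:
  shows "integrable M (\<lambda>\<omega>. W h \<omega> ^ k)"
    and "expectation (\<lambda>\<omega>. W h \<omega> ^ k) = norm h ^ k * (LINT x|std_normal_distribution. x ^ k)"
proof -
  obtain u where u: "norm h = 0 \<or> norm u = 1" "h = norm h *\<^sub>R u"
    by (cases "h = 0") (auto intro: that[of "h /\<^sub>R norm h"])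
  have int: "integrable M (\<lambda>\<omega>. (norm h * W u \<omega>) ^ k)"
    and E: "expectation (\<lambda>\<omega>. (norm h * W u \<omega>) ^ k) = norm h ^ k * (LINT x|std_normal_distribution. x ^ k)"
  proof -
    have "integrable M (\<lambda>\<omega>. (norm h * W u \<omega>) ^ k) \<and>
      expectation (\<lambda>\<omega>. (norm h * W u \<omega>) ^ k) = norm h ^ k * (LINT x|std_normal_distribution. x ^ k)"
    \<comment> \<open>For \<open>h = 0\<close> both sides vanish unless \<open>k = 0\<close>; then
      \<open>0 ^ 0 = 1\<close> and both equal the total mass 1.\<close>
    proof (cases "norm h = 0")
      case True
      interpret normal: real_distribution std_normal_distribution by (rule real_dist_normal_dist)
      have "measure std_normal_distribution UNIV = 1" using normal.prob_space by simp
      with True show ?thesis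
        by (cases k) (simp_all add: prob_space del: norm_eq_zero)
    next
      case False
      then have "norm u = 1" using u by simp
      note Y = std_normal_moments(1,2)[OF W_measurable std_normal_W[OF this], of k]
      show ?thesis using Y by (simp add: power_mult_distrib)
    qed
    then show "integrable M (\<lambda>\<omega>. (norm h * W u \<omega>) ^ k)"
      "expectation (\<lambda>\<omega>. (norm h * W u \<omega>) ^ k) = norm h ^ k * (LINT x|std_normal_distribution. x ^ k)" by auto
  qed
  have ae: "AE \<omega> in M. (norm h * W u \<omega>) ^ k = W h \<omega> ^ k"
    using W_scale[of "norm h" u] u(2) by (auto elim: eventually_mono)
  show "integrable M (\<lambda>\<omega>. W h \<omega> ^ k)"
    using int by (subst integrable_cong_AE[OF _ _ ae, symmetric]) auto
  show "expectation (\<lambda>\<omega>. W h \<omega> ^ k) = norm h ^ k * (LINT x|std_normal_distribution. x ^ k)"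
    using E by (subst integral_cong_AE[OF _ _ ae, symmetric]) auto
qed

text \<open>By Pythagoras the variance of a combination of orthonormal directions is the sum of the
  squared coefficients, so the joint characteristic function factorises.\<close>

lemma indep_vars_W:
  assumes on: "\<And>m n. m \<in> I \<Longrightarrow> n \<in> I \<Longrightarrow> inner (\<phi> m) (\<phi> n) = (if m = n then 1 else 0)" and I: "finite I"
  shows "indep_vars (\<lambda>_. borel) (\<lambda>n. W (\<phi> n)) I"
proof (rule indep_vars_of_char_factorization[OF I W_measurable])
  fix c
  have n1: "norm (\<phi> n) = 1" if "n \<in> I" for n
    using on[OF that that] by (simp add: norm_eq_sqrt_inner)
  have "(CLINT \<omega>|M. iexp (\<Sum>i\<in>I. c i * W (\<phi> i) \<omega>)) = (CLINT \<omega>|M. iexp (W (\<Sum>i\<in>I. c i *\<^sub>R \<phi> i) \<omega>))"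
    using W_sum[OF I, of c \<phi>] by (intro integral_cong_AE) (auto simp del: of_real_sum)
  also have "\<dots> = exp (- (norm (\<Sum>i\<in>I. c i *\<^sub>R \<phi> i))\<^sup>2 / 2)"
    by (rule W_char)
  also have "(norm (\<Sum>i\<in>I. c i *\<^sub>R \<phi> i))\<^sup>2 = (\<Sum>i\<in>I. (c i)\<^sup>2)"
    by (rule orthonormal_norm_sum[OF on I])
  also have "exp (- (\<Sum>i\<in>I. (c i)\<^sup>2) / 2) = (\<Prod>i\<in>I. exp (- (c i)\<^sup>2 / 2))"
    using I by (simp add: exp_sum[symmetric] sum_negf sum_divide_distrib)
  also have "of_real \<dots> = (\<Prod>i\<in>I. CLINT \<omega>|M. iexp (c i * W (\<phi> i) \<omega>))"
    unfolding of_real_prod by (intro prod.cong refl) (simp add: char_scaled n1 del: of_real_mult)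
  finally show "(CLINT \<omega>|M. iexp (\<Sum>i\<in>I. c i * W (\<phi> i) \<omega>)) = (\<Prod>i\<in>I. CLINT \<omega>|M. iexp (c i * W (\<phi> i) \<omega>))" .
qed

text \<open>The finite sum is taken at every \<omega>, which keeps it exactly linear in
  \<open>h\<close>; \<open>W (fourier_sum \<phi> N h)\<close> agrees with it only off a null set
  depending on \<open>N\<close> and \<open>h\<close>.\<close>

definition partial_sum :: "(nat \<Rightarrow> 'h) \<Rightarrow> nat \<Rightarrow> 'h \<Rightarrow> 'w \<Rightarrow> real" where
  "partial_sum \<phi> N h \<omega> = (\<Sum>n=1..N. inner (\<phi> n) h * W (\<phi> n) \<omega>)"

lemma partial_sum_measurable[measurable]: "partial_sum \<phi> N h \<in> borel_measurable M"
  unfolding partial_sum_def by measurable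

lemma partial_sum_diff: "partial_sum \<phi> N (h - k) \<omega> = partial_sum \<phi> N h \<omega> - partial_sum \<phi> N k \<omega>"
  by (simp add: partial_sum_def inner_diff_right left_diff_distrib sum_subtractf)

lemma partial_sum_AE: "AE \<omega> in M. W (fourier_sum \<phi> N h) \<omega> = partial_sum \<phi> N h \<omega>"
  unfolding fourier_sum_def partial_sum_def by (rule W_sum) simp

text \<open>For the first \<open>n\<close> sums Doob's inequality bounds the probability by a moment
  of the last one, and Bessel makes this bound free of \<open>n\<close>. The events increase with
  \<open>n\<close>, so it passes to the supremum over all \<open>N\<close>.\<close>

lemma partial_sum_maximal:
  assumes \<phi>: "orthonormal_basis_seq \<phi>" and q: "even q" "0 < q" and a: "0 < a"
  shows "prob {\<omega> \<in> space M. \<exists>N. a \<le> \<bar>partial_sum \<phi> N h \<omega>\<bar>} \<le>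
    norm h ^ q * (LINT x|std_normal_distribution. x ^ q) / a ^ q"
proof -
  let ?c = "LINT x|std_normal_distribution. x ^ q"
  have c: "0 \<le> ?c" using q by (intro integral_nonneg_AE) (auto simp: zero_le_even_power)
  define A where "A n = {\<omega> \<in> space M. \<exists>k\<le>n. a \<le> \<bar>partial_sum \<phi> k h \<omega>\<bar>}" for n
  have [measurable]: "A n \<in> sets M" for n
    unfolding A_def by measurable
  have on: "inner (\<phi> m) (\<phi> n) = (if m = n then 1 else 0)" if "m \<in> {1..N}" "n \<in> {1..N}" for m n N
    using \<phi> that by (simp add: orthonormal_basis_seq_def)
  have le: "prob (A n) \<le> norm h ^ q * ?c / a ^ q" for n
  proof -
    let ?X = "\<lambda>i \<omega>. inner (\<phi> i) h * W (\<phi> i) \<omega>"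
    have mom: "integrable M (\<lambda>\<omega>. partial_sum \<phi> k h \<omega> ^ q)"
      "expectation (\<lambda>\<omega>. partial_sum \<phi> k h \<omega> ^ q) = norm (fourier_sum \<phi> k h) ^ q * ?c" for k
    proof -
      have ae: "AE \<omega> in M. W (fourier_sum \<phi> k h) \<omega> ^ q = partial_sum \<phi> k h \<omega> ^ q"
        using partial_sum_AE[of \<phi> k h] by (auto elim: eventually_mono)
      show "integrable M (\<lambda>\<omega>. partial_sum \<phi> k h \<omega> ^ q)"
        using W_moments(1) by (subst integrable_cong_AE[OF _ _ ae, symmetric]) auto
      show "expectation (\<lambda>\<omega>. partial_sum \<phi> k h \<omega> ^ q) = norm (fourier_sum \<phi> k h) ^ q * ?c"
        using W_moments(2) by (subst integral_cong_AE[OF _ _ ae, symmetric]) auto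
    qed
    have "indep_vars (\<lambda>_. borel) (\<lambda>i. (\<lambda>x. inner (\<phi> i) h * x) \<circ> W (\<phi> i)) {1..n}"
      by (intro indep_vars_compose[OF indep_vars_W] on) auto
    then have ind: "indep_vars (\<lambda>_. borel) ?X {1..n}" by (simp add: comp_def)
    have "prob {\<omega> \<in> space M. \<exists>k\<le>n. a \<le> \<bar>\<Sum>i=1..k. ?X i \<omega>\<bar>} \<le> expectation (\<lambda>\<omega>. (\<Sum>i=1..n. ?X i \<omega>) ^ q) / a ^ q"
    proof (rule moment_maximal_inequality[OF ind _ _ _ q a])
      have odd: "(LINT x|std_normal_distribution. x) = 0"
        using integral_std_normal_distribution_moment_odd[of 1] by simp
      show "integrable M (?X i)" "expectation (?X i) = 0" for i
        using W_moments[of "\<phi> i" 1] odd by simp_all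
      show "integrable M (\<lambda>\<omega>. (\<Sum>i=1..k. ?X i \<omega>) ^ q)" for k
        using mom(1)[of k] by (simp add: partial_sum_def)
    qed
    also have "\<dots> = norm (fourier_sum \<phi> n h) ^ q * ?c / a ^ q"
      using mom(2)[of n] by (simp add: partial_sum_def)
    also have "\<dots> \<le> norm h ^ q * ?c / a ^ q"
      using c a norm_fourier_sum_le[OF \<phi>] by (intro divide_right_mono mult_right_mono power_mono) auto
    finally show ?thesis by (simp add: A_def partial_sum_def)
  qed
  have "(\<lambda>n. prob (A n)) \<longlonglongrightarrow> prob (\<Union>n. A n)"
    by (rule finite_Lim_measure_incseq) (auto simp: incseq_def A_def intro: order_trans)
  then have "prob (\<Union>n. A n) \<le> norm h ^ q * ?c / a ^ q"
    by (rule LIMSEQ_le_const2) (use le in blast)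
  moreover have "(\<Union>n. A n) = {\<omega> \<in> space M. \<exists>N. a \<le> \<bar>partial_sum \<phi> N h \<omega>\<bar>}"
    by (auto simp: A_def)
  ultimately show ?thesis by simp
qed

lemma W_chebyshev:
  assumes "0 < e"
  shows "prob {\<omega> \<in> space M. e \<le> \<bar>W h \<omega>\<bar>} \<le> (norm h)\<^sup>2 / e\<^sup>2"
proof -
  have v: "expectation (\<lambda>\<omega>. (W h \<omega>)\<^sup>2) = (norm h)\<^sup>2"
    using W_moments(2)[of h 2] std_normal_distribution_even_moments(1)[of 1] by simp
  have "prob {\<omega> \<in> space M. e\<^sup>2 \<le> (W h \<omega>)\<^sup>2} \<le> expectation (\<lambda>\<omega>. (W h \<omega>)\<^sup>2) / e\<^sup>2"
    using assms W_moments(1)[of h 2] by (intro integral_Markov_inequality_measure[where A = "{}"]) auto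
  moreover have "e\<^sup>2 \<le> (W h \<omega>)\<^sup>2 \<longleftrightarrow> e \<le> \<bar>W h \<omega>\<bar>" for \<omega>
    using assms by (simp add: abs_le_square_iff[symmetric])
  ultimately show ?thesis by (simp add: v)
qed

text \<open>Uniform tail control: for \<open>N \<ge> m\<close> the increment of the partial sums after \<open>m\<close> is the
  partial sum of the remainder \<open>h - fourier_sum \<phi> m h\<close>.\<close>

lemma partial_sum_tendsto:
  assumes \<phi>: "orthonormal_basis_seq \<phi>"
  shows "AE \<omega> in M. (\<lambda>N. partial_sum \<phi> N h \<omega>) \<longlonglongrightarrow> W h \<omega>"
proof -
  have near: "AE \<omega> in M. \<exists>m. \<forall>N\<ge>m. \<bar>partial_sum \<phi> N h \<omega> - W h \<omega>\<bar> < 2 * e" if e: "0 < e" for e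
  proof -
    let ?bad = "{\<omega> \<in> space M. \<not> (\<exists>m. \<forall>N\<ge>m. \<bar>partial_sum \<phi> N h \<omega> - W h \<omega>\<bar> < 2 * e)}"
    define r where "r m = h - fourier_sum \<phi> m h" for m
    \<comment> \<open>The bad event does not involve \<open>m\<close>; letting \<open>m\<close> tend
      to infinity makes its probability 0.\<close>
    have le: "prob ?bad \<le> 2 * ((norm (r m))\<^sup>2 / e\<^sup>2)" for m
    proof -
      let ?U = "{\<omega> \<in> space M. \<exists>N. e \<le> \<bar>partial_sum \<phi> N (r m) \<omega>\<bar>}"
      let ?V = "{\<omega> \<in> space M. e \<le> \<bar>W (r m) \<omega>\<bar>}"
      \<comment> \<open>From index \<open>m\<close> on, the partial sums of the projection of
        \<open>h\<close> no longer change, so those of \<open>r m\<close> are the tail increments of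
        those of \<open>h\<close>.\<close>
      have fs: "partial_sum \<phi> N (fourier_sum \<phi> m h) \<omega> = partial_sum \<phi> m h \<omega>" if "m \<le> N" for N \<omega>
      proof -
        have "inner (\<phi> n) (fourier_sum \<phi> m h) = (if n \<in> {1..m} then inner (\<phi> n) h else 0)" if "n \<in> {1..N}" for n
        proof -
          have "inner (\<phi> n) (fourier_sum \<phi> m h) = (\<Sum>k=1..m. if k = n then inner (\<phi> n) h else 0)"
            unfolding fourier_sum_def inner_sum_right using \<phi> that
            by (intro sum.cong) (auto simp: orthonormal_basis_seq_def)
          then show ?thesis by simp
        qed
        then have "partial_sum \<phi> N (fourier_sum \<phi> m h) \<omega> = (\<Sum>n=1..N. if n \<in> {1..m} then inner (\<phi> n) h * W (\<phi> n) \<omega> else 0)"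
          unfolding partial_sum_def by (intro sum.cong) auto
        also have "\<dots> = (\<Sum>n\<in>{1..N} \<inter> {1..m}. inner (\<phi> n) h * W (\<phi> n) \<omega>)"
          by (rule sum.inter_restrict[symmetric]) simp
        also have "{1..N} \<inter> {1..m} = {1..m}" using that by auto
        finally show ?thesis by (simp add: partial_sum_def)
      qed
      have "AE \<omega> in M. W (r m) \<omega> = W h \<omega> - partial_sum \<phi> m h \<omega>"
        using W_diff[of h "fourier_sum \<phi> m h"] partial_sum_AE[of \<phi> m h]
        unfolding r_def by eventually_elim simp
      then have "AE \<omega> in M. \<omega> \<in> ?bad \<longrightarrow> \<omega> \<in> ?U \<union> ?V"
      proof eventually_elim
        case (elim \<omega>)
        show ?case
        proof (intro impI, rule ccontr)
          assume bad: "\<omega> \<in> ?bad" and "\<omega> \<notin> ?U \<union> ?V"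
          then have UV: "\<And>N. \<bar>partial_sum \<phi> N (r m) \<omega>\<bar> < e" "\<bar>W (r m) \<omega>\<bar> < e"
            by (auto simp: not_le)
          have "\<bar>partial_sum \<phi> N h \<omega> - W h \<omega>\<bar> < 2 * e" if "m \<le> N" for N
            using UV(1)[of N] UV(2) elim fs[OF that, of \<omega>] by (simp add: r_def partial_sum_diff)
          then show False using bad by blast
        qed
      qed
      then have "prob ?bad \<le> prob (?U \<union> ?V)"
        by (intro finite_measure_mono_AE) auto
      also have "\<dots> \<le> prob ?U + prob ?V"
        by (intro measure_Un_le) auto
      also have "\<dots> \<le> (norm (r m))\<^sup>2 / e\<^sup>2 + (norm (r m))\<^sup>2 / e\<^sup>2"
        using partial_sum_maximal[OF \<phi>, of 2 e "r m"] W_chebyshev[OF e, of "r m"]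
          std_normal_distribution_even_moments(1)[of 1] e by (intro add_mono) simp_all
      finally show ?thesis by simp
    qed
    have "r \<longlonglongrightarrow> h - h" unfolding r_def by (intro tendsto_intros fourier_sum_tendsto[OF \<phi>])
    then have "(\<lambda>m. 2 * ((norm (r m))\<^sup>2 / e\<^sup>2)) \<longlonglongrightarrow> 2 * ((norm (h - h))\<^sup>2 / e\<^sup>2)"
      using e by (intro tendsto_intros) auto
    then have "prob ?bad \<le> 2 * ((norm (h - h))\<^sup>2 / e\<^sup>2)"
      by (rule LIMSEQ_le_const) (use le in blast)
    then have "prob ?bad = 0" by (simp add: measure_le_0_iff)
    then show ?thesis
      by (intro AE_I[of _ _ ?bad]) (auto simp: emeasure_eq_measure)
  qed
  \<comment> \<open>Countably many tolerances suffice and leave a single null set.\<close>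
  have "AE \<omega> in M. \<forall>j. \<exists>m. \<forall>N\<ge>m. \<bar>partial_sum \<phi> N h \<omega> - W h \<omega>\<bar> < 2 * inverse (real (Suc j))"
    unfolding AE_all_countable using near by simp
  then show ?thesis
  proof eventually_elim
    case (elim \<omega>)
    show ?case
    proof (rule LIMSEQ_I)
      fix e :: real assume "0 < e"
      then obtain j where "inverse (real (Suc j)) < e / 2"
        using reals_Archimedean[of "e / 2"] by auto
      then show "\<exists>m. \<forall>N\<ge>m. norm (partial_sum \<phi> N h \<omega> - W h \<omega>) < e"
        using elim[rule_format, of j] by (force intro: less_trans)
    qed
  qed
qed

text \<open>Kolmogorov's moment argument applied to the supremum over \<open>N\<close>: the maximal
  inequality for the Hilbert space increments of \<open>h\<close> replaces a moment bound at a fixed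
  \<open>N\<close>.\<close>

lemma partial_sum_dyadic_increments:
  fixes h :: "real \<Rightarrow> 'h"
  assumes \<phi>: "orthonormal_basis_seq \<phi>" and C: "0 \<le> C" and g: "\<gamma> < H"
    and h: "\<And>s t. s \<in> {0..1} \<Longrightarrow> t \<in> {0..1} \<Longrightarrow> norm (h t - h s) \<le> C * \<bar>t - s\<bar> powr H"
  shows "AE \<omega> in M. \<exists>K\<ge>0. \<forall>N n. dyadic_increments_le n (\<lambda>t. partial_sum \<phi> N (h t) \<omega>) (K * (2 powr -\<gamma>) ^ n)"
proof -
  \<comment> \<open>The choice makes \<open>q * (H - \<gamma>) > 1\<close> for the even exponent
    \<open>q = 2 * m\<close>, which beats the \<open>2 ^ n\<close> increments of level
    \<open>n\<close>.\<close>
  obtain m :: nat where m: "1 / (H - \<gamma>) < real m"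
    using reals_Archimedean2 by blast
  define q where "q = 2 * m"
  have "0 < 1 / (H - \<gamma>)" using g by simp
  then have "0 < m" using m by (metis less_trans of_nat_0_less_iff)
  then have q: "even q" "0 < q" by (auto simp: q_def)
  have "1 < real m * (H - \<gamma>)" using m g by (simp add: field_simps)
  moreover have "0 < real m * (H - \<gamma>)" using \<open>0 < m\<close> g by simp
  ultimately have qg: "1 < real q * (H - \<gamma>)" by (simp add: q_def)
  let ?c = "LINT x|std_normal_distribution. x ^ q"
  have c: "0 \<le> ?c" using q by (intro integral_nonneg_AE) (auto simp: zero_le_even_power)
  let ?a = "\<lambda>n. (2 powr -\<gamma>) ^ n :: real"
  let ?d = "\<lambda>n k. h (real (Suc k) / 2 ^ n) - h (real k / 2 ^ n)"
  define E where "E n k = {\<omega> \<in> space M. \<exists>N. ?a n \<le> \<bar>partial_sum \<phi> N (?d n k) \<omega>\<bar>}" for n k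
  have [measurable]: "E n k \<in> sets M" for n k unfolding E_def by measurable
  define F where "F n = (\<Union>k<2 ^ n. E n k)" for n
  have [measurable]: "F n \<in> sets M" for n unfolding F_def by measurable
  \<comment> \<open>The ratio of the geometric series bounding \<open>prob (F n)\<close>: the 1 in
    the exponent counts the increments of a level, the rest is the moment bound for one of
    them.\<close>
  define \<rho> where "\<rho> = 2 powr (1 - real q * (H - \<gamma>))"
  have \<rho>: "0 < \<rho>" "\<rho> < 1" using qg by (simp_all add: \<rho>_def powr_less_one)
  have E_le: "prob (E n k) \<le> C ^ q * ?c * (\<rho> ^ n / 2 ^ n)" if k: "k < 2 ^ n" for n k
  proof -
    have "real (Suc k) \<le> 2 ^ n" using k by (metis Suc_leI of_nat_le_iff of_nat_numeral of_nat_power)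
    moreover have "k \<le> 2 ^ n" using k by simp
    ultimately have mem: "real (Suc k) / 2 ^ n \<in> {0..1}" "real k / 2 ^ n \<in> {0..1}" by simp_all
    have "real (Suc k) / 2 ^ n - real k / 2 ^ n = 2 powr - real n"
      by (simp add: diff_divide_distrib[symmetric] powr_minus powr_realpow inverse_eq_divide)
    then have nd: "norm (?d n k) \<le> C * (2 powr - real n) powr H"
      using h[OF mem(2,1)] by simp
    have "prob (E n k) \<le> norm (?d n k) ^ q * ?c / ?a n ^ q"
      unfolding E_def by (rule partial_sum_maximal[OF \<phi> q]) simp
    also have "\<dots> \<le> (C * (2 powr - real n) powr H) ^ q * ?c / ?a n ^ q"
      using nd c by (intro divide_right_mono mult_right_mono power_mono) auto
    also have "\<dots> = C ^ q * ?c * (((2 powr - real n) powr H) ^ q / ?a n ^ q)"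
      by (simp add: power_mult_distrib)
    also have "((2 powr - real n) powr H) ^ q / ?a n ^ q = \<rho> ^ n / 2 ^ n"
    proof -
      have p: "(2 powr x) ^ k = 2 powr (x * real k)" for x :: real and k
        by (simp add: powr_powr[symmetric] powr_realpow)
      have "((2 powr - real n) powr H) ^ q / ?a n ^ q = 2 powr (- real n * H * real q - (- \<gamma> * real n * real q))"
        by (simp only: p powr_powr powr_diff)
      also have "\<dots> = 2 powr ((1 - real q * (H - \<gamma>)) * real n - real n)"
        by (simp add: algebra_simps)
      also have "\<dots> = 2 powr ((1 - real q * (H - \<gamma>)) * real n) / 2 powr real n"
        by (rule powr_diff)
      also have "\<dots> = \<rho> ^ n / 2 ^ n"
        by (simp only: \<rho>_def p powr_realpow zero_less_numeral)
      finally show ?thesis .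
    qed
    finally show ?thesis .
  qed
  have F_le: "prob (F n) \<le> C ^ q * ?c * \<rho> ^ n" for n
  proof -
    have "prob (F n) \<le> (\<Sum>k<2 ^ n. prob (E n k))"
      unfolding F_def by (intro finite_measure_subadditive_finite) auto
    also have "\<dots> \<le> (\<Sum>k<(2::nat) ^ n. C ^ q * ?c * (\<rho> ^ n / 2 ^ n))"
      using E_le by (intro sum_mono) auto
    finally show ?thesis by simp
  qed
  have "summable (\<lambda>n. prob (F n))"
  proof (rule summable_comparison_test')
    show "summable (\<lambda>n. C ^ q * ?c * \<rho> ^ n)"
      using \<rho> by (intro summable_mult summable_geometric) auto
    show "norm (prob (F n)) \<le> C ^ q * ?c * \<rho> ^ n" for n using F_le by simp
  qed
  then have bc: "AE \<omega> in M. \<forall>\<^sub>F n in sequentially. \<omega> \<in> space M - F n"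
    by (intro borel_cantelli_AE1) (auto simp: less_top[symmetric])
  \<comment> \<open>Convergence serves here to bound each coarse increment uniformly in
    \<open>N\<close>, where Borel-Cantelli says nothing.\<close>
  have conv: "AE \<omega> in M. \<forall>n k. (\<lambda>N. partial_sum \<phi> N (?d n k) \<omega>) \<longlonglongrightarrow> W (?d n k) \<omega>"
    unfolding AE_all_countable using partial_sum_tendsto[OF \<phi>] by blast
  from bc conv show ?thesis
  proof eventually_elim
    case (elim \<omega>)
    from elim(1) obtain n0 where n0: "\<And>n. n \<ge> n0 \<Longrightarrow> \<omega> \<in> space M - F n"
      by (auto simp: eventually_sequentially)
    define b where "b n k = (SOME b. \<forall>N. \<bar>partial_sum \<phi> N (?d n k) \<omega>\<bar> \<le> b)" for n k
    have b: "\<bar>partial_sum \<phi> N (?d n k) \<omega>\<bar> \<le> b n k" for n k N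
    proof -
      have "\<exists>b. \<forall>N. \<bar>partial_sum \<phi> N (?d n k) \<omega>\<bar> \<le> b"
        using convergent_imp_bounded[OF elim(2)[THEN spec, of n, THEN spec, of k]]
        by (auto simp: bounded_iff)
      then show ?thesis
        unfolding b_def by (rule someI2_ex) blast
    qed
    have b0: "0 \<le> b n k" for n k using b[of 0 k n] by linarith
    \<comment> \<open>The summand 1 covers the levels from \<open>n0\<close> on, the finite sum all
      increments of the levels below.\<close>
    define K where "K = 1 + (\<Sum>n<n0. \<Sum>k<2 ^ n. b n k / ?a n)"
    have K1: "1 \<le> K"
      unfolding K_def using b0 by (simp add: sum_nonneg)
    have "dyadic_increments_le n (\<lambda>t. partial_sum \<phi> N (h t) \<omega>) (K * ?a n)" for N n
      unfolding dyadic_increments_le_def partial_sum_diff[symmetric]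
    proof (intro allI impI)
      fix k :: nat assume k: "k < 2 ^ n"
      show "\<bar>partial_sum \<phi> N (?d n k) \<omega>\<bar> \<le> K * ?a n"
      proof (cases "n \<ge> n0")
        case True
        then have "\<omega> \<in> space M - E n k" using n0[OF True] k by (auto simp: F_def)
        then have "\<bar>partial_sum \<phi> N (?d n k) \<omega>\<bar> \<le> 1 * ?a n" by (auto simp: E_def not_le intro: less_imp_le)
        also have "\<dots> \<le> K * ?a n" using K1 by (intro mult_right_mono) auto
        finally show ?thesis .
      next
        case False
        have "b n k / ?a n \<le> (\<Sum>k<2 ^ n. b n k / ?a n)"
          using k b0 by (intro member_le_sum) auto
        also have "\<dots> \<le> (\<Sum>n<n0. \<Sum>k<2 ^ n. b n k / ?a n)"
          using False b0 by (intro member_le_sum[where f = "\<lambda>n. \<Sum>k<2 ^ n. b n k / ?a n"]) (auto intro!: sum_nonneg)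
        finally have "b n k / ?a n \<le> K" by (simp add: K_def)
        then have "b n k \<le> K * ?a n" by (simp add: pos_divide_le_eq)
        with b[of N k n] show ?thesis by linarith
      qed
    qed
    with K1 show ?case by (intro exI[of _ K]) auto
  qed
qed

end

section \<open>Bifractional Brownian motion: convergence of the series\<close>

text \<open>Jensen's inequality for the concave power \<open>b\<close>; dividing by the mean
  \<open>s / 2\<close> reduces it to the tangent at 1.\<close>

lemma powr_add_le_concave:
  fixes x y b :: real
  assumes "0 \<le> x" "0 \<le> y" "0 < b" "b \<le> 1"
  shows "x powr b + y powr b \<le> 2 powr (1 - b) * (x + y) powr b"
proof (cases "x = 0 \<and> y = 0")
  case False
  define s where "s = x + y"
  have s: "0 < s" using False assms by (auto simp: s_def less_le add_nonneg_eq_0_iff)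
  \<comment> \<open>The tangent bound at 1 is Young's inequality with weights \<open>b\<close> and
    \<open>1 - b\<close> for \<open>u\<close> and 1. For \<open>u = 2 * x / s\<close> and
    \<open>u = 2 * y / s\<close> the linear terms cancel.\<close>
  have bern: "u powr b \<le> 1 + b * (u - 1)" if "0 \<le> u" for u :: real
    using Youngs_inequality_0[of b "1 - b" u 1] that assms by (cases "u = 0") (auto simp: algebra_simps)
  have "x powr b = (s / 2) powr b * (2 * x / s) powr b" "y powr b = (s / 2) powr b * (2 * y / s) powr b"
    using s assms by (simp_all add: powr_mult[symmetric])
  then have "x powr b + y powr b = (s / 2) powr b * ((2 * x / s) powr b + (2 * y / s) powr b)"
    by (simp add: distrib_left)
  also have "\<dots> \<le> (s / 2) powr b * ((1 + b * (2 * x / s - 1)) + (1 + b * (2 * y / s - 1)))"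
    using s assms by (intro mult_left_mono add_mono bern) auto
  also have "(1 + b * (2 * x / s - 1)) + (1 + b * (2 * y / s - 1)) = 2"
  proof -
    have "(1 + b * (2 * x / s - 1)) + (1 + b * (2 * y / s - 1)) = 2 + b * (2 * ((x + y) / s) - 2)"
      by (simp add: algebra_simps add_divide_distrib)
    also have "(x + y) / s = 1" using s by (simp add: s_def)
    finally show ?thesis by simp
  qed
  also have "(s / 2) powr b * 2 = 2 powr (1 - b) * s powr b"
    using s by (simp add: powr_divide powr_diff)
  finally show ?thesis by (simp add: s_def)
qed (use assms in simp)

text \<open>The left side is the variance of an increment. By concavity its terms without
  \<open>\<bar>t - s\<bar>\<close> add up to at most 0; what remains has the factor
  \<open>2 powr (1 - \<beta>)\<close>, which is at most 2.\<close>

lemma bifbm_increment_le: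
  assumes a: "0 < \<alpha>" and b: "0 < \<beta>" "\<beta> \<le> 1" and st: "0 \<le> s" "0 \<le> t"
  shows "bifbm_cov \<alpha> \<beta> t t + bifbm_cov \<alpha> \<beta> s s - 2 * bifbm_cov \<alpha> \<beta> s t \<le> 2 * \<bar>t - s\<bar> powr (2 * \<alpha> * \<beta>)"
proof -
  have diag: "bifbm_cov \<alpha> \<beta> u u = (u powr (2 * \<alpha>)) powr \<beta>" if "0 \<le> u" for u
  proof -
    have "(u powr (2 * \<alpha>) + u powr (2 * \<alpha>)) powr \<beta> = (2 * u powr (2 * \<alpha>)) powr \<beta>" by simp
    also have "\<dots> = 2 powr \<beta> * (u powr (2 * \<alpha>)) powr \<beta>" by (simp add: powr_mult)
    finally show ?thesis using a b by (simp add: bifbm_cov_def)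
  qed
  have two: "2 / 2 powr \<beta> = (2 powr (1 - \<beta>) :: real)" by (simp add: powr_diff)
  have "2 * bifbm_cov \<alpha> \<beta> s t = 2 / 2 powr \<beta> * ((t powr (2 * \<alpha>) + s powr (2 * \<alpha>)) powr \<beta> - \<bar>t - s\<bar> powr (2 * \<alpha> * \<beta>))"
    by (simp add: bifbm_cov_def)
  then have "bifbm_cov \<alpha> \<beta> t t + bifbm_cov \<alpha> \<beta> s s - 2 * bifbm_cov \<alpha> \<beta> s t \<le> 2 powr (1 - \<beta>) * \<bar>t - s\<bar> powr (2 * \<alpha> * \<beta>)"
    unfolding two using powr_add_le_concave[of "t powr (2 * \<alpha>)" "s powr (2 * \<alpha>)" \<beta>] b st
    by (simp add: diag right_diff_distrib)
  also have "\<dots> \<le> 2 powr 1 * \<bar>t - s\<bar> powr (2 * \<alpha> * \<beta>)"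
    using b by (intro mult_right_mono powr_mono) auto
  finally show ?thesis by simp
qed

theorem theorem4p1:
  fixes M :: "'w measure"
    and B :: "real \<Rightarrow> 'w \<Rightarrow> real"
    and \<iota> :: "(real \<Rightarrow> real) \<Rightarrow> 'h::{real_inner, complete_space}"
    and W :: "'h \<Rightarrow> 'w \<Rightarrow> real"
    and \<phi> :: "nat \<Rightarrow> 'h"
    and \<alpha> \<beta> \<epsilon> p :: real
  assumes "prob_space M"
    and "0 < \<alpha>" "\<alpha> < 1" "0 < \<beta>" "\<beta> \<le> 1" "\<alpha> * \<beta> > 1 / 2"
    and "bifractional_brownian_motion M \<alpha> \<beta> B"
    and "bifbm_hilbert_completion \<alpha> \<beta> \<iota>"
    and "wiener_integral M B \<iota> W"
    and "orthonormal_basis_seq \<phi>"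
    and "\<epsilon> > 0" "p \<ge> 1" "1 / 2 < \<alpha> * \<beta> - \<epsilon> - 1 / p"
  shows "AE \<omega> in M. converges_in_Bes (\<alpha> * \<beta> - \<epsilon>) p
           (\<lambda>N t. \<Sum>n=1..N. inner (\<phi> n) (\<iota> (indicator {0..t})) * W (\<phi> n) \<omega>)
           (\<lambda>t. B t \<omega>)"
proof -
  interpret prob_space M by (rule assms(1))
  have B: "gaussian_process M B" "\<And>t. t \<in> {0..1} \<Longrightarrow> expectation (B t) = 0"
    "\<And>\<omega>. \<omega> \<in> space M \<Longrightarrow> continuous_on {0..1} (\<lambda>t. B t \<omega>)"
    using assms(7) by (auto simp: bifractional_brownian_motion_def)
  have Wg: "W h \<in> gaussian_space M B" for h
    using assms(9) by (simp add: wiener_integral_def)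
  \<comment> \<open>The isometry turns the second moment in the characteristic function of a
    Gaussian space element into the squared Hilbert space norm.\<close>
  interpret isonormal_process M W
  proof
    fix h
    show "W h \<in> borel_measurable M" using Wg[of h] by (simp add: gaussian_space_def L2_space_def)
    have "sqrt (expectation (\<lambda>\<omega>. (W h \<omega>)\<^sup>2)) = norm h"
      using assms(9) by (simp add: wiener_integral_def)
    then have "expectation (\<lambda>\<omega>. (W h \<omega>)\<^sup>2) = (norm h)\<^sup>2"
      by (metis integral_nonneg_AE real_sqrt_pow2 zero_le_power2 AE_I2)
    then show "(CLINT \<omega>|M. iexp (W h \<omega>)) = exp (- (norm h)\<^sup>2 / 2)"
      using gaussian_space_char[OF B(1,2) Wg[of h]] by simp
  next
    show "AE \<omega> in M. W (a *\<^sub>R h + b *\<^sub>R k) \<omega> = a * W h \<omega> + b * W k \<omega>" for a b h k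
      using assms(9) by (simp add: wiener_integral_def)
  qed
  define h where "h t = \<iota> (indicator {0..t})" for t
  define H where "H = \<alpha> * \<beta>"
  define \<gamma> where "\<gamma> = H - \<epsilon>"
  \<comment> \<open>The midpoint leaves room on both sides: below \<open>H\<close> for the moment
    argument, above \<gamma> for the smallness of fine increments.\<close>
  define \<gamma>' where "\<gamma>' = H - \<epsilon> / 2"
  have "0 < 1 / p" using assms(12) by simp
  then have \<gamma>: "0 < \<gamma>" "\<gamma> < \<gamma>'" "\<gamma>' < H"
    using assms(11,13) unfolding \<gamma>_def \<gamma>'_def H_def by linarith+
  have inner_h: "inner (h t) (h s) = bifbm_cov \<alpha> \<beta> s t" if "s \<in> {0..1}" "t \<in> {0..1}" for s t
    using assms(8) that by (simp add: bifbm_hilbert_completion_def h_def)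
  have h: "norm (h t - h s) \<le> sqrt 2 * \<bar>t - s\<bar> powr H" if "s \<in> {0..1}" "t \<in> {0..1}" for s t
  proof -
    have "(norm (h t - h s))\<^sup>2 = bifbm_cov \<alpha> \<beta> t t + bifbm_cov \<alpha> \<beta> s s - 2 * bifbm_cov \<alpha> \<beta> s t"
      using inner_h that by (simp add: power2_norm_eq_inner inner_diff_left inner_diff_right inner_commute[of "h s" "h t"])
    also have "\<dots> \<le> 2 * \<bar>t - s\<bar> powr (2 * \<alpha> * \<beta>)"
      using assms that by (intro bifbm_increment_le) auto
    also have "\<dots> = (sqrt 2 * \<bar>t - s\<bar> powr H)\<^sup>2"
      by (simp add: power_mult_distrib H_def power2_eq_square powr_add[symmetric] mult_ac)
    finally show ?thesis by (rule power2_le_imp_le) simp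
  qed
  \<comment> \<open>This makes every partial sum continuous in time, as chaining requires.\<close>
  have h_cont: "continuous_on {0..1} h"
    unfolding continuous_on_def
  proof
    fix s :: real assume s: "s \<in> {0..1}"
    have "((\<lambda>t. sqrt 2 * \<bar>t - s\<bar> powr H) \<longlongrightarrow> sqrt 2 * \<bar>s - s\<bar> powr H) (at s within {0..1})"
      using \<gamma> by (intro tendsto_intros tendsto_powr') auto
    then have "((\<lambda>t. sqrt 2 * \<bar>t - s\<bar> powr H) \<longlongrightarrow> 0) (at s within {0..1})" by simp
    then have "((\<lambda>t. h t - h s) \<longlongrightarrow> 0) (at s within {0..1})"
      by (rule Lim_null_comparison[rotated]) (use h s in \<open>auto simp: eventually_at_filter\<close>)
    then show "(h \<longlongrightarrow> h s) (at s within {0..1})" by (rule LIM_zero_cancel)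
  qed
  have WB: "AE \<omega> in M. W (h t) \<omega> = B t \<omega>" if "t \<in> {0..1}" for t
    using assms(9) that by (simp add: wiener_integral_def h_def)
  \<comment> \<open>There are countably many dyadic points, so one null set serves them all;
    continuity of the paths handles the other times.\<close>
  have lim: "AE \<omega> in M. \<forall>n k. k \<le> 2 ^ n \<longrightarrow>
      (\<lambda>N. partial_sum \<phi> N (h (real k / 2 ^ n)) \<omega>) \<longlonglongrightarrow> B (real k / 2 ^ n) \<omega>"
    unfolding AE_all_countable
  proof (intro allI)
    fix n k :: nat
    show "AE \<omega> in M. k \<le> 2 ^ n \<longrightarrow>
      (\<lambda>N. partial_sum \<phi> N (h (real k / 2 ^ n)) \<omega>) \<longlonglongrightarrow> B (real k / 2 ^ n) \<omega>"
    proof (cases "k \<le> 2 ^ n")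
      case True
      then have "real k \<le> 2 ^ n" by (metis of_nat_le_iff of_nat_numeral of_nat_power)
      then have "real k / 2 ^ n \<in> {0..1}" by simp
      from partial_sum_tendsto[OF assms(10), of "h (real k / 2 ^ n)"] WB[OF this] show ?thesis
        by eventually_elim simp
    qed simp
  qed
  have inc: "AE \<omega> in M. \<exists>K\<ge>0. \<forall>N n. dyadic_increments_le n (\<lambda>t. partial_sum \<phi> N (h t) \<omega>) (K * (2 powr -\<gamma>') ^ n)"
    by (rule partial_sum_dyadic_increments[OF assms(10) _ \<gamma>(3) h]) simp_all
  have "AE \<omega> in M. converges_in_Bes \<gamma> p (\<lambda>N t. partial_sum \<phi> N (h t) \<omega>) (\<lambda>t. B t \<omega>)"
    using AE_space lim inc
  proof eventually_elim
    case (elim \<omega>)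
    then obtain K where "0 \<le> K"
      "\<And>N n. dyadic_increments_le n (\<lambda>t. partial_sum \<phi> N (h t) \<omega>) (K * (2 powr -\<gamma>') ^ n)" by blast
    moreover have "continuous_on {0..1} (\<lambda>t. partial_sum \<phi> N (h t) \<omega>)" for N
      unfolding partial_sum_def by (intro continuous_intros h_cont)
    ultimately show ?case
      using elim(1,2) B(3) by (intro converges_in_Bes_of_dyadic_increments[OF assms(12) \<gamma>(1,2)]) auto
  qed
  then show ?thesis
    by (simp add: partial_sum_def h_def \<gamma>_def H_def)
qed

end
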